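(* Let $X$ be a symplectic manifold with a compatible almost complex structure (not necessarily Kähler). Let $\mathbb{C}P^1$ carry its standard symplectic form and complex structure and the marked points $p_0=[0:1]$, $p_1=[1:0]$. If through any two points of $X$ there passes a pseudoholomorphic sphere (i.e. for all $p,q\in X$ there is a pseudoholomorphic map $f:\mathbb{C}P^1\to X$ with $p,q\in f(\mathbb{C}P^1)$), then $JH_0^{\mathbb{C}P^1}(pt,X)=\mathbb{Z}$.
   Context: All manifolds are smooth without boundary (and nonempty); products carry product structures; $pt$ is a point. Let $Y,X$ be symplectic manifolds with compatible almost complex structures $J_Y,J_X$. A smooth map $f$ is pseudoholomorphic if $df\circ J_Y=J_X\circ df$. Pseudoholomorphic correspondences: for $n\ge 1$, $JCor_n(Y,X)$ is the set of global sections over $Y$ of the sheafification of the presheaf sending an open $U\subset Y$ to the set of unordered $n$-tuples $\{f_1,\dots,f_n\}$ of pseudoholomorphic maps $U\to X$, where two tuples are identified if $\{f_1(y),\dots,f_n(y)\}=\{g_1(y),\dots,g_n(y)\}$ as unordered tuples (with multiplicity) for every $y\in U$. $JCor_0(Y,X)$ consists of one element, the empty correspondence $\emptyset$. $JCor(Y,X)$ is the set of global sections over $Y$ of the sheafification of $U\mapsto\coprod_{n\ge 0}JCor_n(U,X)$. Addition is local concatenation of tuples, making $JCor(Y,X)$ a commutative monoid with zero $\emptyset$; $JC(Y,X)$ is its Grothendieck group. Thus $JC(pt,X)=\mathbb{Z}[X]$, the free abelian group on the points of $X$. A pseudoholomorphic map $h:Z\to Y$ induces a homomorphism $h^*:JC(Y,X)\to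 JC(Z,X)$, locally $\{f_i\}\mapsto\{f_i\circ h\}$. Cohomology groups: let $M=(M,\omega_M,J_M,p_0,p_1)$ be a connected symplectic manifold with compatible almost complex structure and two marked points, $M^0=pt$. Put $JC_n^M(Y,X)=JC(Y\times M^n,X)$. For $0\le i\le n-1$, $\varepsilon\in\{0,1\}$ let $d_{i,\varepsilon}:M^{n-1}\to M^n$ insert $p_\varepsilon$ after the first $i$ factors, $d^{i,\varepsilon}=(id_Y\times d_{i,\varepsilon})^*$, and $d=\sum_{\varepsilon=0}^1\sum_{i=0}^{n-1}(-1)^{\varepsilon+i}d^{i,\varepsilon}:JC^M_n(Y,X)\to JC^M_{n-1}(Y,X)$. Then $d^2=0$ and $JH_n^M(Y,X)$, $n\geq 0$, is the homology of this complex in degree $n$. *)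

theory Defs
  imports
    "HOL-Analysis.Analysis"
    "HOL-Algebra.FiniteProduct"
    "HOL-Algebra.Elementary_Groups"
    "HOL-Library.Multiset"
begin

section \<open>Smooth functions on open subsets of Euclidean space\<close>

text \<open>
  The \<^term>\<open>n\<close>-dimensional coordinate space is the library's
  \<^term>\<open>Euclidean_space n :: (nat \<Rightarrow> real) topology\<close>, whose points are the sequences vanishing
  from index \<^term>\<open>n\<close> on. Keeping the dimension a number (not a type) is what allows the powers
  \<open>M^n\<close> to be formed for a variable \<open>n\<close>. The class topology on \<^typ>\<open>nat \<Rightarrow> real\<close> is the
  product topology, so \<^const>\<open>continuous_on\<close> below is continuity for the Euclidean topology.
\<close>

definition partial_deriv :: "nat \<Rightarrow> ((nat \<Rightarrow> real) \<Rightarrow> real) \<Rightarrow> (nat \<Rightarrow> real) \<Rightarrow> real" where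
  "partial_deriv i f x = deriv (\<lambda>t. f (x(i := t))) (x i)"

fun Ck_on :: "nat \<Rightarrow> nat \<Rightarrow> (nat \<Rightarrow> real) set \<Rightarrow> ((nat \<Rightarrow> real) \<Rightarrow> real) \<Rightarrow> bool" where
  "Ck_on d 0 U f \<longleftrightarrow> continuous_on U f"
| "Ck_on d (Suc k) U f \<longleftrightarrow> continuous_on U f \<and>
     (\<forall>i<d. (\<forall>x\<in>U. (\<lambda>t. f (x(i := t))) field_differentiable (at (x i))) \<and>
            Ck_on d k U (partial_deriv i f))"

text \<open>Only meant for \<^term>\<open>U\<close> open in \<^term>\<open>Euclidean_space d\<close>.\<close>

definition smooth_on :: "nat \<Rightarrow> (nat \<Rightarrow> real) set \<Rightarrow> ((nat \<Rightarrow> real) \<Rightarrow> real) \<Rightarrow> bool" where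
  "smooth_on d U f \<longleftrightarrow> (\<forall>k. Ck_on d k U f)"

definition jacobian :: "((nat \<Rightarrow> real) \<Rightarrow> (nat \<Rightarrow> real)) \<Rightarrow> (nat \<Rightarrow> real) \<Rightarrow> nat \<Rightarrow> nat \<Rightarrow> real" where
  "jacobian F x a b = partial_deriv b (\<lambda>y. F y a) x"

definition mat_app :: "nat \<Rightarrow> (nat \<Rightarrow> nat \<Rightarrow> real) \<Rightarrow> (nat \<Rightarrow> real) \<Rightarrow> nat \<Rightarrow> real" where
  "mat_app d A v a = (\<Sum>b<d. A a b * v b)"

definition bilin :: "nat \<Rightarrow> (nat \<Rightarrow> nat \<Rightarrow> real) \<Rightarrow> (nat \<Rightarrow> real) \<Rightarrow> (nat \<Rightarrow> real) \<Rightarrow> real" where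
  "bilin d A v w = (\<Sum>a<d. \<Sum>b<d. A a b * v a * w b)"


section \<open>Symplectic manifolds with compatible almost complex structure\<close>

text \<open>
  A manifold is given by a topology and an atlas; the atlas is indexed, so that charts of products
  are indexed by tuples of indices. Tensors are given by their components in each chart:
  \<open>omega M c p a b\<close> is \<open>\<omega>(\<partial>\<^sub>a, \<partial>\<^sub>b)\<close> at \<open>p\<close>, and \<open>acs M c p a b\<close> is the entry in row \<open>a\<close> and
  column \<open>b\<close> of the matrix of \<open>J\<close> at \<open>p\<close>, that is \<open>J \<partial>\<^sub>b = \<Sum>\<^sub>a (acs M c p a b) \<partial>\<^sub>a\<close>, in the
  coordinates of the chart with index \<open>c\<close>. Only entries with \<open>a, b\<close> below the dimension matter.
\<close>

record ('a, 'i) ac_mfd =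
  mtop :: "'a topology"
  mdim :: nat
  atlas :: "'i set"
  cdom :: "'i \<Rightarrow> 'a set"
  chart :: "'i \<Rightarrow> 'a \<Rightarrow> nat \<Rightarrow> real"
  omega :: "'i \<Rightarrow> 'a \<Rightarrow> nat \<Rightarrow> nat \<Rightarrow> real"
  acs :: "'i \<Rightarrow> 'a \<Rightarrow> nat \<Rightarrow> nat \<Rightarrow> real"

abbreviation points :: "('a, 'i) ac_mfd \<Rightarrow> 'a set" where
  "points M \<equiv> topspace (mtop M)"

definition cinv :: "('a, 'i) ac_mfd \<Rightarrow> 'i \<Rightarrow> (nat \<Rightarrow> real) \<Rightarrow> 'a" where
  "cinv M c = inv_into (cdom M c) (chart M c)"

definition coord_rep ::
  "('a, 'i) ac_mfd \<Rightarrow> ('b, 'j) ac_mfd \<Rightarrow> 'i \<Rightarrow> 'j \<Rightarrow> ('a \<Rightarrow> 'b) \<Rightarrow> (nat \<Rightarrow> real) \<Rightarrow> (nat \<Rightarrow> real)" where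
  "coord_rep M N c c' f = (\<lambda>x. chart N c' (f (cinv M c x)))"

locale smooth_manifold =
  fixes M :: "('a, 'i) ac_mfd"
  assumes nonempty: "points M \<noteq> {}"
    and hausdorff: "Hausdorff_space (mtop M)"
    and second_countable: "second_countable (mtop M)"
    and cover: "(\<Union>c\<in>atlas M. cdom M c) = points M"
    and cdom_open: "c \<in> atlas M \<Longrightarrow> openin (mtop M) (cdom M c)"
    and chart_open: "c \<in> atlas M \<Longrightarrow> openin (Euclidean_space (mdim M)) (chart M c ` cdom M c)"
    and chart_homeo: "c \<in> atlas M \<Longrightarrow>
      homeomorphic_map (subtopology (mtop M) (cdom M c))
        (subtopology (Euclidean_space (mdim M)) (chart M c ` cdom M c)) (chart M c)"
    and transition_smooth: "\<lbrakk>c \<in> atlas M; c' \<in> atlas M; a < mdim M\<rbrakk> \<Longrightarrow>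
      smooth_on (mdim M) (chart M c ` (cdom M c \<inter> cdom M c')) (\<lambda>x. coord_rep M M c c' id x a)"

locale symplectic_manifold = smooth_manifold M for M :: "('a, 'i) ac_mfd" +
  assumes omega_smooth: "\<lbrakk>c \<in> atlas M; a < mdim M; b < mdim M\<rbrakk> \<Longrightarrow>
      smooth_on (mdim M) (chart M c ` cdom M c) (\<lambda>x. omega M c (cinv M c x) a b)"
    and omega_tensor: "\<lbrakk>c \<in> atlas M; c' \<in> atlas M; p \<in> cdom M c \<inter> cdom M c'\<rbrakk> \<Longrightarrow>
      bilin (mdim M) (omega M c p) v w =
      bilin (mdim M) (omega M c' p)
        (mat_app (mdim M) (jacobian (coord_rep M M c c' id) (chart M c p)) v)
        (mat_app (mdim M) (jacobian (coord_rep M M c c' id) (chart M c p)) w)"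
    and omega_alternating: "\<lbrakk>c \<in> atlas M; p \<in> cdom M c; a < mdim M; b < mdim M\<rbrakk> \<Longrightarrow>
      omega M c p a b = - omega M c p b a"
    and omega_nondegenerate: "\<lbrakk>c \<in> atlas M; p \<in> cdom M c;
        \<And>w. bilin (mdim M) (omega M c p) v w = 0; a < mdim M\<rbrakk> \<Longrightarrow> v a = 0"
    and omega_closed: "\<lbrakk>c \<in> atlas M; x \<in> chart M c ` cdom M c;
        i < mdim M; j < mdim M; k < mdim M\<rbrakk> \<Longrightarrow>
      partial_deriv i (\<lambda>y. omega M c (cinv M c y) j k) x +
      partial_deriv j (\<lambda>y. omega M c (cinv M c y) k i) x +
      partial_deriv k (\<lambda>y. omega M c (cinv M c y) i j) x = 0"

locale compatible_ac_manifold = symplectic_manifold M for M :: "('a, 'i) ac_mfd" +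
  assumes acs_smooth: "\<lbrakk>c \<in> atlas M; a < mdim M; b < mdim M\<rbrakk> \<Longrightarrow>
      smooth_on (mdim M) (chart M c ` cdom M c) (\<lambda>x. acs M c (cinv M c x) a b)"
    and acs_tensor: "\<lbrakk>c \<in> atlas M; c' \<in> atlas M; p \<in> cdom M c \<inter> cdom M c'; a < mdim M\<rbrakk> \<Longrightarrow>
      mat_app (mdim M) (jacobian (coord_rep M M c c' id) (chart M c p))
        (mat_app (mdim M) (acs M c p) v) a =
      mat_app (mdim M) (acs M c' p)
        (mat_app (mdim M) (jacobian (coord_rep M M c c' id) (chart M c p)) v) a"
    and acs_square: "\<lbrakk>c \<in> atlas M; p \<in> cdom M c; a < mdim M\<rbrakk> \<Longrightarrow>
      mat_app (mdim M) (acs M c p) (mat_app (mdim M) (acs M c p) v) a = - v a"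
    and omega_acs_invariant: "\<lbrakk>c \<in> atlas M; p \<in> cdom M c\<rbrakk> \<Longrightarrow>
      bilin (mdim M) (omega M c p)
        (mat_app (mdim M) (acs M c p) v) (mat_app (mdim M) (acs M c p) w) =
      bilin (mdim M) (omega M c p) v w"
    and omega_acs_positive: "\<lbrakk>c \<in> atlas M; p \<in> cdom M c; a < mdim M; v a \<noteq> 0\<rbrakk> \<Longrightarrow>
      bilin (mdim M) (omega M c p) v (mat_app (mdim M) (acs M c p) v) > 0"

text \<open>
  Pseudoholomorphic maps \<open>U \<rightarrow> X\<close> for \<open>U\<close> open in \<open>Y\<close>: smooth, with \<open>df \<circ> J\<^sub>Y = J\<^sub>X \<circ> df\<close>,
  expressed in all pairs of charts. Values outside \<open>U\<close> are irrelevant.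
\<close>

definition pholo_on :: "('y, 'j) ac_mfd \<Rightarrow> ('x, 'i) ac_mfd \<Rightarrow> 'y set \<Rightarrow> ('y \<Rightarrow> 'x) \<Rightarrow> bool" where
  "pholo_on Y X U f \<longleftrightarrow>
     continuous_map (subtopology (mtop Y) U) (mtop X) f \<and>
     (\<forall>c\<in>atlas Y. \<forall>c'\<in>atlas X. let W = {p \<in> U \<inter> cdom Y c. f p \<in> cdom X c'} in
        (\<forall>a<mdim X. smooth_on (mdim Y) (chart Y c ` W) (\<lambda>x. coord_rep Y X c c' f x a)) \<and>
        (\<forall>p\<in>W. \<forall>v. \<forall>a<mdim X.
           mat_app (mdim Y) (jacobian (coord_rep Y X c c' f) (chart Y c p))
             (mat_app (mdim Y) (acs Y c p) v) a =
           mat_app (mdim X) (acs X c' (f p))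
             (mat_app (mdim Y) (jacobian (coord_rep Y X c c' f) (chart Y c p)) v) a))"

abbreviation pholo :: "('y, 'j) ac_mfd \<Rightarrow> ('x, 'i) ac_mfd \<Rightarrow> ('y \<Rightarrow> 'x) \<Rightarrow> bool" where
  "pholo Y X f \<equiv> pholo_on Y X (points Y) f"


section \<open>The point, products and powers\<close>

definition pt_mfd :: "(unit, unit) ac_mfd" where
  "pt_mfd = \<lparr>mtop = discrete_topology UNIV, mdim = 0, atlas = UNIV, cdom = (\<lambda>_. UNIV),
     chart = (\<lambda>_ _ _. 0), omega = (\<lambda>_ _ _ _. 0), acs = (\<lambda>_ _ _ _. 0)\<rparr>"

definition block_sum ::
  "nat \<Rightarrow> nat \<Rightarrow> (nat \<Rightarrow> nat \<Rightarrow> real) \<Rightarrow> (nat \<Rightarrow> nat \<Rightarrow> real) \<Rightarrow> nat \<Rightarrow> nat \<Rightarrow> real" where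
  "block_sum d e A B a b =
     (if a < d \<and> b < d then A a b
      else if d \<le> a \<and> a < d + e \<and> d \<le> b \<and> b < d + e then B (a - d) (b - d)
      else 0)"

definition prod_mfd ::
  "('a, 'i) ac_mfd \<Rightarrow> ('b, 'j) ac_mfd \<Rightarrow> ('a \<times> 'b, 'i \<times> 'j) ac_mfd" where
  "prod_mfd M N =
     \<lparr>mtop = prod_topology (mtop M) (mtop N),
      mdim = mdim M + mdim N,
      atlas = atlas M \<times> atlas N,
      cdom = (\<lambda>(c, e). cdom M c \<times> cdom N e),
      chart = (\<lambda>(c, e) (x, y) k. if k < mdim M then chart M c x k
                                else if k < mdim M + mdim N then chart N e y (k - mdim M)
                                else 0),
      omega = (\<lambda>(c, e) (x, y). block_sum (mdim M) (mdim N) (omega M c x) (omega N e y)),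
      acs = (\<lambda>(c, e) (x, y). block_sum (mdim M) (mdim N) (acs M c x) (acs N e y))\<rparr>"

text \<open>
  A point of \<open>M^n\<close> is an extensional function on \<open>{..<n}\<close>, so \<open>M^0\<close> is a single point. Coordinate
  \<open>k\<close> of \<open>M^n\<close> is coordinate \<open>k mod d\<close> of factor \<open>k div d\<close>, where \<open>d\<close> is the dimension of \<open>M\<close>.
\<close>

definition block_power ::
  "nat \<Rightarrow> nat \<Rightarrow> (nat \<Rightarrow> nat \<Rightarrow> nat \<Rightarrow> real) \<Rightarrow> nat \<Rightarrow> nat \<Rightarrow> real" where
  "block_power n d A a b =
     (if a < n * d \<and> b < n * d \<and> a div d = b div d then A (a div d) (a mod d) (b mod d) else 0)"

definition power_mfd :: "('a, 'i) ac_mfd \<Rightarrow> nat \<Rightarrow> (nat \<Rightarrow> 'a, nat \<Rightarrow> 'i) ac_mfd" where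
  "power_mfd M n =
     \<lparr>mtop = product_topology (\<lambda>_. mtop M) {..<n},
      mdim = n * mdim M,
      atlas = {..<n} \<rightarrow>\<^sub>E atlas M,
      cdom = (\<lambda>c. \<Pi>\<^sub>E l\<in>{..<n}. cdom M (c l)),
      chart = (\<lambda>c x k. if k < n * mdim M
                       then chart M (c (k div mdim M)) (x (k div mdim M)) (k mod mdim M) else 0),
      omega = (\<lambda>c x. block_power n (mdim M) (\<lambda>l. omega M (c l) (x l))),
      acs = (\<lambda>c x. block_power n (mdim M) (\<lambda>l. acs M (c l) (x l)))\<rparr>"


section \<open>The complex projective line\<close>

text \<open>A point \<open>[a:b]\<close> is the set of its homogeneous coordinates.\<close>

definition hpoint :: "complex \<Rightarrow> complex \<Rightarrow> (complex \<times> complex) set" where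
  "hpoint a b = {(t * a, t * b) | t. t \<noteq> 0}"

definition CP1_points :: "(complex \<times> complex) set set" where
  "CP1_points = {hpoint a b | a b. (a, b) \<noteq> (0, 0)}"

text \<open>
  The quotient topology from \<open>\<complex>\<^sup>2 - {0}\<close>: the preimage of a set \<open>U\<close> of points is its union.
\<close>

definition CP1_top :: "(complex \<times> complex) set topology" where
  "CP1_top = topology (\<lambda>U. U \<subseteq> CP1_points \<and> open (\<Union>U))"

text \<open>
  Chart \<^const>\<open>False\<close> is \<open>z = z\<^sub>0 / z\<^sub>1\<close> on \<open>z\<^sub>1 \<noteq> 0\<close>, chart \<^const>\<open>True\<close> is \<open>w = z\<^sub>1 / z\<^sub>0\<close> on
  \<open>z\<^sub>0 \<noteq> 0\<close>. In both, \<open>J\<close> is multiplication by \<open>\<i>\<close>, and the form is the Fubini-Study form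
  \<open>dx \<and> dy / (1 + \<bar>z\<bar>\<^sup>2)\<^sup>2\<close>, normalised to have total area \<open>\<pi>\<close>.
\<close>

definition CP1_coord :: "bool \<Rightarrow> (complex \<times> complex) set \<Rightarrow> complex" where
  "CP1_coord c P = (if c then (THE w. (1, w) \<in> P) else (THE z. (z, 1) \<in> P))"

definition CP1 :: "((complex \<times> complex) set, bool) ac_mfd" where
  "CP1 =
     \<lparr>mtop = CP1_top,
      mdim = 2,
      atlas = UNIV,
      cdom = (\<lambda>c. {hpoint z0 z1 | z0 z1. (if c then z0 else z1) \<noteq> 0}),
      chart = (\<lambda>c P k. if k = 0 then Re (CP1_coord c P)
                       else if k = 1 then Im (CP1_coord c P) else 0),
      omega = (\<lambda>c P a b. (if (a, b) = (0, 1) then 1 else if (a, b) = (1, 0) then -1 else 0)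
                         / (1 + (cmod (CP1_coord c P))\<^sup>2)\<^sup>2),
      acs = (\<lambda>c P a b. if (a, b) = (1, 0) then 1 else if (a, b) = (0, 1) then -1 else 0)\<rparr>"

lemma openin_CP1_top: "openin CP1_top U \<longleftrightarrow> U \<subseteq> CP1_points \<and> open (\<Union>U)"
proof -
  have hp: "hpoint (s * a) (s * b) = hpoint a b" if "s \<noteq> 0" for s a b
  proof
    show "hpoint (s * a) (s * b) \<subseteq> hpoint a b"
    proof
      fix x assume "x \<in> hpoint (s * a) (s * b)"
      then obtain t where "t \<noteq> 0" "x = (t * (s * a), t * (s * b))"
        by (auto simp: hpoint_def)
      then have "t * s \<noteq> 0" "x = ((t * s) * a, (t * s) * b)"
        using that by auto
      then show "x \<in> hpoint a b"
        unfolding hpoint_def by blast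
    qed
    show "hpoint a b \<subseteq> hpoint (s * a) (s * b)"
    proof
      fix x assume "x \<in> hpoint a b"
      then obtain t where "t \<noteq> 0" "x = (t * a, t * b)"
        by (auto simp: hpoint_def)
      then have "t / s \<noteq> 0" "x = ((t / s) * (s * a), (t / s) * (s * b))"
        using that by auto
      then show "x \<in> hpoint (s * a) (s * b)"
        unfolding hpoint_def by blast
    qed
  qed
  have eq: "P = hpoint (fst x) (snd x)" if PP: "P \<in> CP1_points" and xP: "x \<in> P" for P x
  proof -
    obtain a b where P: "P = hpoint a b"
      using PP unfolding CP1_points_def by blast
    then obtain t where "t \<noteq> 0" "x = (t * a, t * b)"
      using xP P by (auto simp: hpoint_def)
    then show ?thesis
      using hp[of t a b] P by simp
  qed
  have "\<Union>(S \<inter> T) = \<Union>S \<inter> \<Union>T" if "S \<subseteq> CP1_points" "T \<subseteq> CP1_points" for S T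
  proof
    show "\<Union>S \<inter> \<Union>T \<subseteq> \<Union>(S \<inter> T)"
    proof
      fix x assume "x \<in> \<Union>S \<inter> \<Union>T"
      then obtain P Q where "P \<in> S" "x \<in> P" "Q \<in> T" "x \<in> Q" by auto
      then have "P = Q"
        using eq[of P x] eq[of Q x] that by auto
      then show "x \<in> \<Union>(S \<inter> T)"
        using \<open>P \<in> S\<close> \<open>Q \<in> T\<close> \<open>x \<in> P\<close> by auto
    qed
  qed auto
  moreover have "open (\<Union>(\<Union>\<K>))" if "\<forall>K\<in>\<K>. open (\<Union>K)" for \<K> :: "(complex \<times> complex) set set set"
  proof -
    have "\<Union>(\<Union>\<K>) = (\<Union>K\<in>\<K>. \<Union>K)" by auto
    then show ?thesis using that by auto
  qed
  ultimately have "istopology (\<lambda>U. U \<subseteq> CP1_points \<and> open (\<Union>U))"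
    unfolding istopology_def by (auto simp: open_Int)
  then show ?thesis
    by (simp add: CP1_top_def topology_inverse')
qed


section \<open>Pseudoholomorphic correspondences\<close>

text \<open>
  Two tuples of maps on \<open>U\<close> are identified iff they have the same unordered tuple of values at
  every point, so the class of \<open>{f\<^sub>1, \<dots>, f\<^sub>n}\<close> is represented by the multiset-valued function
  \<open>y \<mapsto> {#f\<^sub>1 y, \<dots>, f\<^sub>n y#}\<close>. The presheaves are therefore presheaves of functions, and their
  sheafification consists of the functions that locally belong to the presheaf. Sections over \<open>U\<close>
  take the dummy value \<open>{#}\<close> outside \<open>U\<close>.
\<close>

definition sec_restrict :: "'y set \<Rightarrow> ('y \<Rightarrow> 'x multiset) \<Rightarrow> ('y \<Rightarrow> 'x multiset)" where
  "sec_restrict U s = (\<lambda>y. if y \<in> U then s y else {#})"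

definition sheafification ::
  "'y topology \<Rightarrow> ('y set \<Rightarrow> ('y \<Rightarrow> 'x multiset) set) \<Rightarrow> 'y set \<Rightarrow> ('y \<Rightarrow> 'x multiset) set" where
  "sheafification T F U =
     {s. sec_restrict U s = s \<and>
         (\<forall>y\<in>U. \<exists>V. openin T V \<and> y \<in> V \<and> V \<subseteq> U \<and> sec_restrict V s \<in> F V)}"

definition tuples :: "nat \<Rightarrow> ('y, 'j) ac_mfd \<Rightarrow> ('x, 'i) ac_mfd \<Rightarrow> 'y set \<Rightarrow> ('y \<Rightarrow> 'x multiset) set" where
  "tuples n Y X U =
     {sec_restrict U (\<lambda>y. mset (map (\<lambda>f. f y) fs)) | fs. length fs = n \<and> (\<forall>f\<in>set fs. pholo_on Y X U f)}"

text \<open>For \<open>n = 0\<close> this is the one-element set consisting of the empty correspondence.\<close>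

definition JCor_n :: "nat \<Rightarrow> ('y, 'j) ac_mfd \<Rightarrow> ('x, 'i) ac_mfd \<Rightarrow> 'y set \<Rightarrow> ('y \<Rightarrow> 'x multiset) set" where
  "JCor_n n Y X U = sheafification (mtop Y) (tuples n Y X) U"

definition JCor :: "('y, 'j) ac_mfd \<Rightarrow> ('x, 'i) ac_mfd \<Rightarrow> ('y \<Rightarrow> 'x multiset) monoid" where
  "JCor Y X =
     \<lparr>carrier = sheafification (mtop Y) (\<lambda>U. \<Union>n. JCor_n n Y X U) (points Y),
      monoid.mult = (\<lambda>s t y. s y + t y),
      one = (\<lambda>_. {#})\<rparr>"

lemma JCor_0:
  assumes "openin (mtop Y) U"
  shows "JCor_n 0 Y X U = {\<lambda>_. {#}}"
proof -
  have t: "tuples 0 Y X V = {\<lambda>_. {#}}" for V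
    by (auto simp: tuples_def sec_restrict_def)
  have "s = (\<lambda>_. {#})" if s: "s \<in> JCor_n 0 Y X U" for s
  proof
    fix y
    show "s y = {#}"
    proof (cases "y \<in> U")
      case True
      then obtain V where "y \<in> V" "sec_restrict V s = (\<lambda>_. {#})"
        using s unfolding JCor_n_def sheafification_def t by auto
      then show ?thesis
        by (metis sec_restrict_def)
    next
      case False
      have "sec_restrict U s = s"
        using s by (simp add: JCor_n_def sheafification_def)
      then show ?thesis
        using False by (metis sec_restrict_def)
    qed
  qed
  moreover have "(\<lambda>_. {#}) \<in> JCor_n 0 Y X U"
    using assms unfolding JCor_n_def sheafification_def t by (auto simp: sec_restrict_def)
  ultimately show ?thesis by blast
qed


section \<open>Grothendieck groups\<close>

definition groth_rel :: "'a monoid \<Rightarrow> (('a \<times> 'a) \<times> ('a \<times> 'a)) set" where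
  "groth_rel G = {((a, b), (c, d)). a \<in> carrier G \<and> b \<in> carrier G \<and> c \<in> carrier G \<and> d \<in> carrier G \<and>
     (\<exists>k\<in>carrier G. a \<otimes>\<^bsub>G\<^esub> d \<otimes>\<^bsub>G\<^esub> k = c \<otimes>\<^bsub>G\<^esub> b \<otimes>\<^bsub>G\<^esub> k)}"

definition groth :: "'a monoid \<Rightarrow> ('a \<times> 'a) set monoid" where
  "groth G =
     \<lparr>carrier = (carrier G \<times> carrier G) // groth_rel G,
      monoid.mult = (\<lambda>A B. \<Union>(a, b)\<in>A. \<Union>(c, d)\<in>B. groth_rel G `` {(a \<otimes>\<^bsub>G\<^esub> c, b \<otimes>\<^bsub>G\<^esub> d)}),
      one = groth_rel G `` {(\<one>\<^bsub>G\<^esub>, \<one>\<^bsub>G\<^esub>)}\<rparr>"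

definition groth_map :: "'b monoid \<Rightarrow> ('a \<Rightarrow> 'b) \<Rightarrow> ('a \<times> 'a) set \<Rightarrow> ('b \<times> 'b) set" where
  "groth_map H h A = (\<Union>(a, b)\<in>A. groth_rel H `` {(h a, h b)})"

type_synonym ('y, 'x) jc = "(('y \<Rightarrow> 'x multiset) \<times> ('y \<Rightarrow> 'x multiset)) set"

definition JC :: "('y, 'j) ac_mfd \<Rightarrow> ('x, 'i) ac_mfd \<Rightarrow> ('y, 'x) jc monoid" where
  "JC Y X = groth (JCor Y X)"

text \<open>The homomorphism \<open>h\<^sup>* : JC(Y, X) \<rightarrow> JC(Z, X)\<close> induced by a pseudoholomorphic map \<open>h : Z \<rightarrow> Y\<close>.\<close>

definition JC_pullback ::
  "('z, 'k) ac_mfd \<Rightarrow> ('x, 'i) ac_mfd \<Rightarrow> ('z \<Rightarrow> 'y) \<Rightarrow> ('y, 'x) jc \<Rightarrow> ('z, 'x) jc" where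
  "JC_pullback Z X h = groth_map (JCor Z X) (\<lambda>s. sec_restrict (points Z) (s \<circ> h))"


section \<open>The cohomology groups\<close>

text \<open>The groups below are abelian but written multiplicatively, following HOL-Algebra.\<close>

definition JC_M ::
  "('m, 'k) ac_mfd \<Rightarrow> nat \<Rightarrow> ('y, 'j) ac_mfd \<Rightarrow> ('x, 'i) ac_mfd \<Rightarrow> ('y \<times> (nat \<Rightarrow> 'm), 'x) jc monoid" where
  "JC_M M n Y X = JC (prod_mfd Y (power_mfd M n)) X"

text \<open>\<open>M^(n-1) \<rightarrow> M^n\<close>, inserting \<open>p\<close> after the first \<open>i\<close> factors.\<close>

definition insert_at :: "nat \<Rightarrow> nat \<Rightarrow> 'm \<Rightarrow> (nat \<Rightarrow> 'm) \<Rightarrow> (nat \<Rightarrow> 'm)" where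
  "insert_at n i p x = (\<lambda>k\<in>{..<n}. if k < i then x k else if k = i then p else x (k - 1))"

definition face ::
  "('m, 'k) ac_mfd \<Rightarrow> 'm \<Rightarrow> 'm \<Rightarrow> nat \<Rightarrow> ('y, 'j) ac_mfd \<Rightarrow> ('x, 'i) ac_mfd \<Rightarrow> nat \<Rightarrow> nat \<Rightarrow>
   ('y \<times> (nat \<Rightarrow> 'm), 'x) jc \<Rightarrow> ('y \<times> (nat \<Rightarrow> 'm), 'x) jc" where
  "face M p0 p1 n Y X i \<epsilon> =
     JC_pullback (prod_mfd Y (power_mfd M (n - 1))) X
       (map_prod id (insert_at n i (if \<epsilon> = 0 then p0 else p1)))"

text \<open>The differential from degree \<open>n\<close> to degree \<open>n - 1\<close>, for \<open>n \<ge> 1\<close>.\<close>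

definition JC_diff ::
  "('m, 'k) ac_mfd \<Rightarrow> 'm \<Rightarrow> 'm \<Rightarrow> nat \<Rightarrow> ('y, 'j) ac_mfd \<Rightarrow> ('x, 'i) ac_mfd \<Rightarrow>
   ('y \<times> (nat \<Rightarrow> 'm), 'x) jc \<Rightarrow> ('y \<times> (nat \<Rightarrow> 'm), 'x) jc" where
  "JC_diff M p0 p1 n Y X z =
     (\<Otimes>\<^bsub>JC_M M (n - 1) Y X\<^esub> \<epsilon>\<in>{0, 1::nat}. \<Otimes>\<^bsub>JC_M M (n - 1) Y X\<^esub> i\<in>{..<n}.
        face M p0 p1 n Y X i \<epsilon> z [^]\<^bsub>JC_M M (n - 1) Y X\<^esub> ((-1) ^ (\<epsilon> + i) :: int))"

definition JC_cycles ::
  "('m, 'k) ac_mfd \<Rightarrow> 'm \<Rightarrow> 'm \<Rightarrow> nat \<Rightarrow> ('y, 'j) ac_mfd \<Rightarrow> ('x, 'i) ac_mfd \<Rightarrow>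
   ('y \<times> (nat \<Rightarrow> 'm), 'x) jc set" where
  "JC_cycles M p0 p1 n Y X =
     (if n = 0 then carrier (JC_M M 0 Y X)
      else kernel (JC_M M n Y X) (JC_M M (n - 1) Y X) (JC_diff M p0 p1 n Y X))"

definition JH ::
  "('m, 'k) ac_mfd \<Rightarrow> 'm \<Rightarrow> 'm \<Rightarrow> nat \<Rightarrow> ('y, 'j) ac_mfd \<Rightarrow> ('x, 'i) ac_mfd \<Rightarrow>
   ('y \<times> (nat \<Rightarrow> 'm), 'x) jc set monoid" where
  "JH M p0 p1 n Y X =
     (JC_M M n Y X)\<lparr>carrier := JC_cycles M p0 p1 n Y X\<rparr>
       Mod (JC_diff M p0 p1 (n + 1) Y X ` carrier (JC_M M (n + 1) Y X))"

end

theory Submission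
  imports Defs "HOL-Complex_Analysis.Cauchy_Integral_Formula"
begin

text \<open>
  A section of the sheaf of correspondences over a connected space has locally constant, hence
  constant, size. So boundaries in degree 0 have degree 0, and the degree induces a surjection of
  \<open>JH\<^sub>0\<close> onto the integers. Conversely, let \<open>{p\<^sub>1, \<dots>, p\<^sub>n}\<close> and \<open>{q\<^sub>1, \<dots>, q\<^sub>n}\<close> be tuples of the same
  size. A sphere through \<open>p\<^sub>i\<close> and \<open>q\<^sub>i\<close>, reparametrised by a projective transformation (or a constant
  sphere if \<open>p\<^sub>i = q\<^sub>i\<close>), takes \<open>[0:1]\<close> to \<open>p\<^sub>i\<close> and \<open>[1:0]\<close> to \<open>q\<^sub>i\<close>. The tuple of these spheres has boundary
  \<open>{p\<^sub>1, \<dots>, p\<^sub>n} - {q\<^sub>1, \<dots>, q\<^sub>n}\<close>. Hence every class of degree 0 is a boundary.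
\<close>

section \<open>Smooth functions and composition with holomorphic functions\<close>

lemma eventually_update_in_open:
  assumes "openin (Euclidean_space d) U" "x \<in> U" "i < d"
  shows "\<forall>\<^sub>F t in nhds (x i). x(i := t) \<in> U"
proof -
  obtain T where T: "open T" "U = T \<inter> topspace (Euclidean_space d)"
    using assms(1) unfolding Euclidean_space_def openin_subtopology
    by (auto simp: euclidean_product_topology)
  have top: "topspace (Euclidean_space d) = {x. \<forall>i\<ge>d. x i = 0}"
    by (auto simp: topspace_Euclidean_space)
  have "continuous_on UNIV (\<lambda>t. (x(i := t)) j)" for j
    by (cases "j = i") auto
  then have "continuous_on UNIV (\<lambda>t. x(i := t))"
    by (rule continuous_on_coordinatewise_then_product)
  then have "open ((\<lambda>t. x(i := t)) -` T)"
    using T(1) by (simp add: continuous_on_open_vimage)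
  then have "\<forall>\<^sub>F t in nhds (x i). t \<in> (\<lambda>t. x(i := t)) -` T"
    by (rule eventually_nhds_in_open) (use assms T in auto)
  then show ?thesis
    by eventually_elim (use assms T(2) top in auto)
qed

lemma partial_deriv_cong:
  assumes "openin (Euclidean_space d) U" "x \<in> U" "i < d" "\<And>y. y \<in> U \<Longrightarrow> f y = g y"
  shows "partial_deriv i f x = partial_deriv i g x"
  unfolding partial_deriv_def
  by (rule deriv_cong_ev)
     (use eventually_update_in_open[OF assms(1-3)] assms(4) in \<open>auto elim!: eventually_mono\<close>)

lemma Ck_on_continuous: "Ck_on d k U f \<Longrightarrow> continuous_on U f"
  by (cases k) auto

lemma Ck_on_subset: "\<lbrakk>Ck_on d k U f; V \<subseteq> U\<rbrakk> \<Longrightarrow> Ck_on d k V f"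
  by (induction k arbitrary: f) (auto intro: continuous_on_subset)

lemma smooth_on_subset: "\<lbrakk>smooth_on d U f; V \<subseteq> U\<rbrakk> \<Longrightarrow> smooth_on d V f"
  unfolding smooth_on_def by (blast intro: Ck_on_subset)

lemma Ck_on_cong:
  assumes "openin (Euclidean_space d) U" "\<And>y. y \<in> U \<Longrightarrow> f y = g y" "Ck_on d k U f"
  shows "Ck_on d k U g"
  using assms(2,3)
proof (induction k arbitrary: f g)
  case 0
  then show ?case by (simp cong: continuous_on_cong)
next
  case (Suc k)
  have "(\<lambda>t. g (x(i := t))) field_differentiable at (x i)" if ix: "i < d" "x \<in> U" for i x
  proof -
    have ev: "\<forall>\<^sub>F t in nhds (x i). f (x(i := t)) = g (x(i := t))"
      using eventually_update_in_open[OF assms(1) ix(2,1)]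
      by eventually_elim (rule Suc.prems(1))
    obtain D where "((\<lambda>t. f (x(i := t))) has_field_derivative D) (at (x i))"
      using Suc.prems(2) ix unfolding Ck_on.simps field_differentiable_def by blast
    then have "((\<lambda>t. g (x(i := t))) has_field_derivative D) (at (x i))"
      using DERIV_cong_ev[OF refl ev refl] by simp
    then show ?thesis by (auto simp: field_differentiable_def)
  qed
  moreover have "Ck_on d k U (partial_deriv i g)" if "i < d" for i
  proof (rule Suc.IH)
    show "partial_deriv i f y = partial_deriv i g y" if "y \<in> U" for y
      using assms(1) that \<open>i < d\<close> Suc.prems(1) by (rule partial_deriv_cong)
    show "Ck_on d k U (partial_deriv i f)" using Suc.prems(2) that by simp
  qed
  moreover have "continuous_on U g"
    using Suc.prems by (simp cong: continuous_on_cong)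
  ultimately show ?case by simp
qed

lemma smooth_on_cong:
  assumes "openin (Euclidean_space d) U" "\<And>y. y \<in> U \<Longrightarrow> f y = g y" "smooth_on d U f"
  shows "smooth_on d U g"
  using assms unfolding smooth_on_def by (blast intro: Ck_on_cong)

lemma continuous_on_local:
  fixes f :: "'a::t2_space \<Rightarrow> 'b::topological_space"
  assumes "\<And>x. x \<in> U \<Longrightarrow> \<exists>V. openin (top_of_set U) V \<and> x \<in> V \<and> continuous_on V f"
  shows "continuous_on U f"
proof -
  have "continuous (at x within U) f" if x: "x \<in> U" for x
  proof -
    obtain V where V: "openin (top_of_set U) V" "x \<in> V" "continuous_on V f"
      using assms[OF x] by blast
    then obtain T where "open T" "V = U \<inter> T" by (auto simp: openin_open)
    then have "at x within V = at x within U"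
      using V(2) by (intro at_within_nhd[of x T]) auto
    then show ?thesis
      using V(2,3) by (metis continuous_on_eq_continuous_within)
  qed
  then show ?thesis by (simp add: continuous_on_eq_continuous_within)
qed

lemma Ck_on_local:
  assumes "\<And>x. x \<in> U \<Longrightarrow> \<exists>V. openin (top_of_set U) V \<and> x \<in> V \<and> Ck_on d k V f"
  shows "Ck_on d k U f"
  using assms
proof (induction k arbitrary: f)
  case 0
  then show ?case using continuous_on_local[of U f] by simp
next
  case (Suc k)
  have "continuous_on U f"
    by (rule continuous_on_local) (use Suc.prems in force)
  moreover have "Ck_on d k U (partial_deriv i f)" if "i < d" for i
    by (rule Suc.IH) (use Suc.prems that in force)
  moreover have "(\<lambda>t. f (x(i := t))) field_differentiable at (x i)" if "i < d" "x \<in> U" for i x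
    using Suc.prems that by fastforce
  ultimately show ?case by auto
qed

lemma Ck_on_Suc_imp: "Ck_on d (Suc k) U f \<Longrightarrow> Ck_on d k U f"
proof (induction k arbitrary: f)
  case (Suc k)
  then have "Ck_on d k U (partial_deriv i f)" if "i < d" for i
    using that by (metis Ck_on.simps(2))
  with Suc.prems show ?case by auto
qed simp

lemma Ck_on_add:
  assumes "openin (Euclidean_space d) U"
  shows "\<lbrakk>Ck_on d k U f; Ck_on d k U g\<rbrakk> \<Longrightarrow> Ck_on d k U (\<lambda>x. f x + g x)"
proof (induction k arbitrary: f g)
  case 0
  then show ?case by (auto intro: continuous_intros)
next
  case (Suc k)
  have "Ck_on d k U (partial_deriv i (\<lambda>x. f x + g x))" if i: "i < d" for i
  proof (rule Ck_on_cong[OF assms])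
    show "Ck_on d k U (\<lambda>x. partial_deriv i f x + partial_deriv i g x)"
      using Suc i by auto
    show "partial_deriv i f x + partial_deriv i g x = partial_deriv i (\<lambda>x. f x + g x) x"
      if "x \<in> U" for x
      using Suc.prems i that by (simp add: partial_deriv_def deriv_add)
  qed
  then show ?case
    using Suc.prems by (auto intro!: continuous_intros field_differentiable_add)
qed

lemma Ck_on_mult:
  assumes "openin (Euclidean_space d) U"
  shows "\<lbrakk>Ck_on d k U f; Ck_on d k U g\<rbrakk> \<Longrightarrow> Ck_on d k U (\<lambda>x. f x * g x)"
proof (induction k arbitrary: f g)
  case 0
  then show ?case by (auto intro: continuous_intros)
next
  case (Suc k)
  have "Ck_on d k U (partial_deriv i (\<lambda>x. f x * g x))" if i: "i < d" for i
  proof (rule Ck_on_cong[OF assms])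
    show "Ck_on d k U (\<lambda>x. f x * partial_deriv i g x + partial_deriv i f x * g x)"
      using Suc i by (intro Ck_on_add[OF assms] Suc.IH) (auto intro: Ck_on_Suc_imp)
    show "f x * partial_deriv i g x + partial_deriv i f x * g x = partial_deriv i (\<lambda>x. f x * g x) x"
      if "x \<in> U" for x
      using Suc.prems i that by (simp add: partial_deriv_def deriv_mult)
  qed
  then show ?case
    using Suc.prems by (auto intro!: continuous_intros field_differentiable_mult)
qed

definition real_vec :: "complex \<Rightarrow> nat \<Rightarrow> real" where
  "real_vec z = (\<lambda>k. if k = 0 then Re z else if k = 1 then Im z else 0)"

definition of_vec :: "(nat \<Rightarrow> real) \<Rightarrow> complex" where
  "of_vec x = Complex (x 0) (x 1)"

lemma of_vec_real_vec [simp]: "of_vec (real_vec z) = z"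
  by (simp add: of_vec_def real_vec_def)

lemma real_vec_simps: "real_vec z 0 = Re z" "real_vec z (Suc 0) = Im z"
  by (simp_all add: real_vec_def)

lemma continuous_real_vec: "continuous_on S real_vec"
  unfolding real_vec_def
proof (rule continuous_on_coordinatewise_then_product)
  show "continuous_on S (\<lambda>z. if i = 0 then Re z else if i = 1 then Im z else 0)" for i :: nat
    by (cases "i = 0"; cases "i = 1") (auto intro: continuous_intros)
qed

lemma continuous_of_vec: "continuous_on S of_vec"
  unfolding of_vec_def
  by (intro continuous_on_Complex continuous_on_subset[OF continuous_on_product_coordinates])
     auto

lemma range_real_vec: "range real_vec = topspace (Euclidean_space 2)"
proof -
  have "x = real_vec (of_vec x)" if "\<forall>i\<ge>2. x i = 0" for x :: "nat \<Rightarrow> real"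
  proof
    show "x i = real_vec (of_vec x) i" for i
      using that by (cases "i = 0"; cases "i = 1") (auto simp: real_vec_def of_vec_def)
  qed
  then show ?thesis
    by (auto simp: topspace_Euclidean_space real_vec_def)
qed

lemma real_vec_image: "real_vec ` S = of_vec -` S \<inter> topspace (Euclidean_space 2)"
  by (auto simp flip: range_real_vec)

lemma openin_real_vec_image:
  assumes "open S"
  shows "openin (Euclidean_space 2) (real_vec ` S)"
proof -
  have "open (of_vec -` S)"
    using assms continuous_of_vec[of UNIV] by (simp add: continuous_on_open_vimage)
  then have "openin (powertop_real UNIV) (of_vec -` S)"
    by (simp add: euclidean_product_topology)
  then show ?thesis
    unfolding real_vec_image Euclidean_space_def by (auto simp: openin_subtopology)
qed

lemma real_vec_update:
  "(real_vec z)(0 := t) = real_vec (Complex t (Im z))"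
  "(real_vec z)(Suc 0 := t) = real_vec (Complex (Re z) t)"
  by (auto simp: real_vec_def)

lemma has_partial_derivatives:
  fixes g :: "complex \<Rightarrow> real"
  assumes "(g has_derivative D) (at z)"
  shows "((\<lambda>t. g (of_vec ((real_vec z)(0 := t)))) has_field_derivative D 1) (at (real_vec z 0))"
    and "((\<lambda>t. g (of_vec ((real_vec z)(Suc 0 := t)))) has_field_derivative D \<i>) (at (real_vec z (Suc 0)))"
proof -
  interpret bounded_linear D using assms by (rule has_derivative_bounded_linear)
  have "((\<lambda>t. Complex t (Im z)) has_derivative (\<lambda>h. of_real h)) (at (Re z))"
    unfolding Complex_eq by (auto intro!: derivative_eq_intros)
  from has_derivative_compose[OF this, of g D] assms
  have "((\<lambda>t. g (Complex t (Im z))) has_derivative (\<lambda>h. D (of_real h))) (at (Re z))"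
    by simp
  moreover have "D (of_real h) = D 1 * h" for h
    using scaleR[of h 1] by (simp add: scaleR_conv_of_real)
  ultimately show "((\<lambda>t. g (of_vec ((real_vec z)(0 := t)))) has_field_derivative D 1) (at (real_vec z 0))"
    unfolding real_vec_update of_vec_real_vec has_field_derivative_def by (simp add: real_vec_def)
  have "((\<lambda>t. Complex (Re z) t) has_derivative (\<lambda>h. \<i> * of_real h)) (at (Im z))"
    unfolding Complex_eq by (auto intro!: derivative_eq_intros)
  from has_derivative_compose[OF this, of g D] assms
  have "((\<lambda>t. g (Complex (Re z) t)) has_derivative (\<lambda>h. D (\<i> * of_real h))) (at (Im z))"
    by simp
  moreover have "D (\<i> * of_real h) = D \<i> * h" for h
    using scaleR[of h \<i>] by (simp add: scaleR_conv_of_real mult.commute)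
  ultimately show "((\<lambda>t. g (of_vec ((real_vec z)(Suc 0 := t)))) has_field_derivative D \<i>) (at (real_vec z (Suc 0)))"
    unfolding real_vec_update of_vec_real_vec has_field_derivative_def by (simp add: real_vec_def)
qed

lemma partial_deriv_of_vec:
  assumes "(g has_derivative D) (at z)"
  shows "partial_deriv 0 (\<lambda>x. g (of_vec x)) (real_vec z) = D 1"
    and "partial_deriv (Suc 0) (\<lambda>x. g (of_vec x)) (real_vec z) = D \<i>"
  unfolding partial_deriv_def using has_partial_derivatives[OF assms] by (auto intro: DERIV_imp_deriv)

lemma Ck_on_of_vec:
  assumes "open S" "\<And>z. z \<in> S \<Longrightarrow> (g has_derivative D z) (at z)"
    and "Ck_on 2 k (real_vec ` S) (\<lambda>x. D (of_vec x) 1)"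
    and "Ck_on 2 k (real_vec ` S) (\<lambda>x. D (of_vec x) \<i>)"
  shows "Ck_on 2 (Suc k) (real_vec ` S) (\<lambda>x. g (of_vec x))"
proof -
  note op = openin_real_vec_image[OF assms(1)]
  have "continuous_on S g"
    using assms(1,2) by (metis continuous_at_imp_continuous_on has_derivative_continuous)
  then have "continuous_on (real_vec ` S) (\<lambda>x. g (of_vec x))"
    by (intro continuous_on_compose2[OF _ continuous_of_vec]) auto
  moreover have "(\<lambda>t. g (of_vec (x(i := t)))) field_differentiable at (x i)"
    if "x \<in> real_vec ` S" "i < 2" for x i
    using that has_partial_derivatives[OF assms(2)]
    by (auto simp: less_2_cases_iff field_differentiable_def)
  moreover have "Ck_on 2 k (real_vec ` S) (partial_deriv i (\<lambda>x. g (of_vec x)))" if "i < 2" for i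
  proof -
    from that consider "i = 0" | "i = Suc 0" by (auto simp: less_2_cases_iff)
    then show ?thesis
    proof cases
      case 1
      show ?thesis unfolding 1
        by (rule Ck_on_cong[OF op _ assms(3)]) (use partial_deriv_of_vec[OF assms(2)] in auto)
    next
      case 2
      show ?thesis unfolding 2
        by (rule Ck_on_cong[OF op _ assms(4)]) (use partial_deriv_of_vec[OF assms(2)] in auto)
    qed
  qed
  ultimately show ?thesis by auto
qed

lemma Ck_on_Re_holomorphic:
  assumes "open S"
  shows "m holomorphic_on S \<Longrightarrow> Ck_on 2 k (real_vec ` S) (\<lambda>x. Re (m (of_vec x)))"
proof (induction k arbitrary: m)
  case 0
  then have "continuous_on S m" by (rule holomorphic_on_imp_continuous_on)
  then have "continuous_on (real_vec ` S) (\<lambda>x. m (of_vec x))"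
    by (intro continuous_on_compose2[OF _ continuous_of_vec]) auto
  then show ?case by (auto intro: continuous_intros)
next
  case (Suc k)
  have d: "deriv m holomorphic_on S" using Suc.prems assms by (rule holomorphic_deriv)
  show ?case
  proof (rule Ck_on_of_vec[OF assms])
    show "((\<lambda>w. Re (m w)) has_derivative (\<lambda>h. Re (deriv m z * h))) (at z)" if "z \<in> S" for z
    proof -
      have "(m has_field_derivative deriv m z) (at z)"
        using Suc.prems assms that by (rule holomorphic_derivI)
      then show ?thesis
        unfolding has_field_derivative_def by (rule has_derivative_Re)
    qed
    show "Ck_on 2 k (real_vec ` S) (\<lambda>x. Re (deriv m (of_vec x) * 1))"
      using Suc.IH[OF d] by simp
    show "Ck_on 2 k (real_vec ` S) (\<lambda>x. Re (deriv m (of_vec x) * \<i>))"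
      by (rule Suc.IH) (intro holomorphic_intros d)
  qed
qed

lemma Ck_on_Im_holomorphic:
  assumes "open S" "m holomorphic_on S"
  shows "Ck_on 2 k (real_vec ` S) (\<lambda>x. Im (m (of_vec x)))"
proof -
  have "(\<lambda>z. - \<i> * m z) holomorphic_on S" by (intro holomorphic_intros assms)
  from Ck_on_Re_holomorphic[OF assms(1) this] show ?thesis by simp
qed

lemma has_derivative_real_vec:
  assumes "open S" "z \<in> S" "Ck_on 2 (Suc 0) (real_vec ` S) F"
  shows "((\<lambda>w. F (real_vec w)) has_derivative
    (\<lambda>h. partial_deriv 0 F (real_vec z) * Re h + partial_deriv (Suc 0) F (real_vec z) * Im h)) (at z)"
proof -
  let ?p0 = "\<lambda>w. partial_deriv 0 F (real_vec w)"
  let ?p1 = "\<lambda>w. partial_deriv (Suc 0) F (real_vec w)"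
  let ?G = "\<lambda>a b. F (real_vec (Complex a b))"
  have "open ((\<lambda>(a, b). Complex a b) -` S)"
  proof -
    have "continuous_on UNIV (\<lambda>(a, b). Complex a b)"
      unfolding case_prod_unfold by (intro continuous_intros)
    then show ?thesis using assms(1) by (simp add: continuous_on_open_vimage)
  qed
  moreover have "(Re z, Im z) \<in> (\<lambda>(a, b). Complex a b) -` S" using assms(2) by simp
  ultimately obtain A B where AB: "open A" "open B" "(Re z, Im z) \<in> A \<times> B"
      "A \<times> B \<subseteq> (\<lambda>(a, b). Complex a b) -` S"
    by (rule open_prod_elim)
  obtain e where e: "e > 0" "ball (Im z) e \<subseteq> B"
    using AB by (metis SigmaE2 openE)
  let ?B = "ball (Im z) e"
  have S: "Complex a b \<in> S" if "a \<in> A" "b \<in> ?B" for a b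
  proof -
    have "(a, b) \<in> A \<times> B" using that e(2) by blast
    then show ?thesis using AB(4) by auto
  qed
  have d0: "((\<lambda>a. ?G a (Im w)) has_real_derivative ?p0 w) (at (Re w))" if "w \<in> S" for w
  proof -
    have "(\<lambda>t. F ((real_vec w)(0 := t))) field_differentiable (at (real_vec w 0))"
      using assms(3) that by auto
    then have "((\<lambda>t. F ((real_vec w)(0 := t))) has_field_derivative ?p0 w) (at (real_vec w 0))"
      unfolding partial_deriv_def by (simp add: field_differentiable_derivI)
    then show ?thesis unfolding real_vec_update by (simp add: real_vec_def)
  qed
  have d1: "((\<lambda>b. ?G (Re w) b) has_real_derivative ?p1 w) (at (Im w))" if "w \<in> S" for w
  proof -
    have "(\<lambda>t. F ((real_vec w)(Suc 0 := t))) field_differentiable (at (real_vec w (Suc 0)))"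
      using assms(3) that by auto
    then have "((\<lambda>t. F ((real_vec w)(Suc 0 := t))) has_field_derivative ?p1 w) (at (real_vec w (Suc 0)))"
      unfolding partial_deriv_def by (simp add: field_differentiable_derivI)
    then show ?thesis unfolding real_vec_update by (simp add: real_vec_def)
  qed
  have c1: "continuous_on S ?p1"
    by (rule continuous_on_compose2[OF _ continuous_real_vec, of "real_vec ` S"])
       (use assms(3) in auto)
  let ?fy = "\<lambda>a b. blinfun_scaleR_left (?p1 (Complex a b)) :: real \<Rightarrow>\<^sub>L real"
  have fx: "((\<lambda>a. ?G a (Im z)) has_derivative (\<lambda>ha. ?p0 z * ha)) (at (Re z) within A)"
    using d0[OF assms(2)] by (simp add: has_field_derivative_def has_derivative_at_withinI)
  have fy: "((\<lambda>b. ?G a b) has_derivative ?fy a b) (at b within ?B)"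
    if "a \<in> A" "b \<in> ?B" for a b
  proof -
    have "(\<lambda>h. ?p1 (Complex a b) * h) = ?fy a b"
      by (rule ext) simp
    then show ?thesis
      using d1[OF S[OF that]] by (simp add: has_field_derivative_def has_derivative_at_withinI)
  qed
  have "continuous_on (A \<times> ?B) (\<lambda>x. ?p1 (Complex (fst x) (snd x)))"
    by (rule continuous_on_compose2[OF c1]) (auto intro!: continuous_intros S)
  then have "continuous_on (A \<times> ?B) (\<lambda>x. blinfun_scaleR_left (?p1 (Complex (fst x) (snd x))) :: real \<Rightarrow>\<^sub>L real)"
    by (rule bounded_linear.continuous_on[OF bounded_linear_blinfun_scaleR_left])
  then have cont: "continuous (at (Re z, Im z) within A \<times> ?B) (\<lambda>(a, b). ?fy a b)"
    unfolding case_prod_unfold continuous_on_eq_continuous_within using AB(3) e(1) by auto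
  have "((\<lambda>(a, b). ?G a b) has_derivative
      (\<lambda>(ha, hb). ?p0 z * ha + ?fy (Re z) (Im z) hb)) (at (Re z, Im z) within A \<times> ?B)"
    by (rule has_derivative_partialsI[OF fx fy cont]) (use e in auto)
  moreover have "(\<lambda>(ha, hb). ?p0 z * ha + ?fy (Re z) (Im z) hb) = (\<lambda>(ha, hb). ?p0 z * ha + ?p1 z * hb)"
    by (rule ext) (simp add: case_prod_unfold)
  moreover have "at (Re z, Im z) within A \<times> ?B = at (Re z, Im z)"
    by (rule at_within_open) (use AB e in \<open>auto intro: open_Times\<close>)
  ultimately have G: "((\<lambda>(a, b). ?G a b) has_derivative
      (\<lambda>(ha, hb). ?p0 z * ha + ?p1 z * hb)) (at (Re z, Im z))"
    by metis
  have "((\<lambda>w. (Re w, Im w)) has_derivative (\<lambda>h. (Re h, Im h))) (at z)"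
    by (auto intro!: derivative_eq_intros)
  from has_derivative_compose[OF this G] show ?thesis by simp
qed

lemma has_derivative_real_vec_compose:
  assumes "open S" "Ck_on 2 (Suc 0) (real_vec ` S) F" "m z \<in> S" "(m has_field_derivative m') (at z)"
  shows "((\<lambda>w. F (real_vec (m w))) has_derivative
    (\<lambda>h. partial_deriv 0 F (real_vec (m z)) * Re (m' * h) +
         partial_deriv (Suc 0) F (real_vec (m z)) * Im (m' * h))) (at z)"
  using has_derivative_compose[OF assms(4)[unfolded has_field_derivative_def]
      has_derivative_real_vec[OF assms(1,3,2)]] .

lemma Ck_on_1: "Ck_on d (Suc k) U f \<Longrightarrow> Ck_on d (Suc 0) U f"
  by (auto intro: Ck_on_continuous)

lemma Ck_on_compose_holomorphic:
  assumes "open S" "open V" "m holomorphic_on V" "m ` V \<subseteq> S"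
  shows "Ck_on 2 k (real_vec ` S) F \<Longrightarrow> Ck_on 2 k (real_vec ` V) (\<lambda>x. F (real_vec (m (of_vec x))))"
proof (induction k arbitrary: F)
  case 0
  have "continuous_on V m" using assms(3) by (rule holomorphic_on_imp_continuous_on)
  then have "continuous_on (real_vec ` V) (\<lambda>x. m (of_vec x))"
    by (intro continuous_on_compose2[OF _ continuous_of_vec]) auto
  then have "continuous_on (real_vec ` V) (\<lambda>x. real_vec (m (of_vec x)))"
    by (intro continuous_on_compose2[OF continuous_real_vec[of UNIV]]) auto
  moreover have "continuous_on (real_vec ` S) F" using 0 by simp
  moreover have "(\<lambda>x. real_vec (m (of_vec x))) ` real_vec ` V \<subseteq> real_vec ` S" using assms(4) by auto
  ultimately show ?case
    unfolding Ck_on.simps by (metis continuous_on_compose2)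
next
  case (Suc k)
  note op = openin_real_vec_image[OF assms(2)]
  have d: "deriv m holomorphic_on V" using assms(3,2) by (rule holomorphic_deriv)
  have R: "Ck_on 2 k (real_vec ` V) (\<lambda>x. Re (deriv m (of_vec x) * c))"
    and I: "Ck_on 2 k (real_vec ` V) (\<lambda>x. Im (deriv m (of_vec x) * c))" for c
    by (intro Ck_on_Re_holomorphic[OF assms(2)] Ck_on_Im_holomorphic[OF assms(2)]
          holomorphic_intros d)+
  have C: "Ck_on 2 k (real_vec ` V) (\<lambda>x. partial_deriv i F (real_vec (m (of_vec x))))" if "i < 2" for i
    using Suc that by auto
  have D: "Ck_on 2 k (real_vec ` V) (\<lambda>x. partial_deriv 0 F (real_vec (m (of_vec x))) * Re (deriv m (of_vec x) * c) +
      partial_deriv (Suc 0) F (real_vec (m (of_vec x))) * Im (deriv m (of_vec x) * c))" for c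
    by (rule Ck_on_add[OF op Ck_on_mult[OF op C R] Ck_on_mult[OF op C I]]) simp_all
  show ?case
  proof (rule Ck_on_of_vec[OF assms(2)])
    show "((\<lambda>w. F (real_vec (m w))) has_derivative
      (\<lambda>h. partial_deriv 0 F (real_vec (m z)) * Re (deriv m z * h) +
         partial_deriv (Suc 0) F (real_vec (m z)) * Im (deriv m z * h))) (at z)" if "z \<in> V" for z
      by (rule has_derivative_real_vec_compose[OF assms(1) Ck_on_1[OF Suc.prems]])
         (use assms that in \<open>auto intro: holomorphic_derivI\<close>)
  qed (rule D)+
qed

section \<open>Pseudoholomorphic maps from a complex coordinate domain\<close>

text \<open>
  The condition of \<^const>\<open>pholo_on\<close> for a map of one complex variable, read in a single chart of
  the target: multiplication by \<open>\<i>\<close> on the source takes \<open>(v\<^sub>0, v\<^sub>1)\<close> to \<open>(-v\<^sub>1, v\<^sub>0)\<close>.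
\<close>

definition holo_rep :: "('x, 'i) ac_mfd \<Rightarrow> 'i \<Rightarrow> complex set \<Rightarrow> (complex \<Rightarrow> 'x) \<Rightarrow> bool" where
  "holo_rep X c S h \<longleftrightarrow>
     (\<forall>a<mdim X. smooth_on 2 (real_vec ` S) (\<lambda>x. chart X c (h (of_vec x)) a)) \<and>
     (\<forall>z\<in>S. \<forall>v. \<forall>a<mdim X.
        mat_app 2 (jacobian (\<lambda>x. chart X c (h (of_vec x))) (real_vec z))
          (\<lambda>k. if k = 0 then - v 1 else v 0) a =
        mat_app (mdim X) (acs X c (h z))
          (mat_app 2 (jacobian (\<lambda>x. chart X c (h (of_vec x))) (real_vec z)) v) a)"

lemma mat_app_2: "mat_app 2 A v a = A a 0 * v 0 + A a (Suc 0) * v (Suc 0)"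
  by (simp add: mat_app_def numeral_2_eq_2)

lemma mat_app_cong:
  "\<lbrakk>\<And>b. b < d \<Longrightarrow> A a b = B a b; \<And>b. b < d \<Longrightarrow> v b = w b\<rbrakk> \<Longrightarrow> mat_app d A v a = mat_app d B w a"
  by (simp add: mat_app_def)

lemma jacobian_cong:
  assumes "open S" "\<And>w. w \<in> S \<Longrightarrow> F (real_vec w) = G (real_vec w)" "z \<in> S" "b < 2"
  shows "jacobian F (real_vec z) a b = jacobian G (real_vec z) a b"
  unfolding jacobian_def
  by (rule partial_deriv_cong[OF openin_real_vec_image[OF assms(1)]]) (use assms in auto)

lemma holo_rep_cong:
  assumes "open S" "\<And>z. z \<in> S \<Longrightarrow> h z = k z" "holo_rep X c S h"
  shows "holo_rep X c S k"
  unfolding holo_rep_def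
proof (intro conjI allI impI ballI)
  fix a assume a: "a < mdim X"
  show "smooth_on 2 (real_vec ` S) (\<lambda>x. chart X c (k (of_vec x)) a)"
    by (rule smooth_on_cong[OF openin_real_vec_image[OF assms(1)],
          of "\<lambda>x. chart X c (h (of_vec x)) a"])
       (use assms(2,3) a in \<open>auto simp: holo_rep_def\<close>)
  fix z v assume z: "z \<in> S"
  let ?H = "jacobian (\<lambda>x. chart X c (h (of_vec x))) (real_vec z)"
  let ?K = "jacobian (\<lambda>x. chart X c (k (of_vec x))) (real_vec z)"
  have J: "?K a b = ?H a b" if "b < 2" for a b
    by (rule jacobian_cong[OF assms(1) _ z that]) (simp add: assms(2))
  have M: "mat_app 2 ?K v = mat_app 2 ?H v" for v
    by (intro ext mat_app_cong) (simp_all add: J)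
  show "mat_app 2 ?K (\<lambda>k. if k = 0 then - v 1 else v 0) a =
      mat_app (mdim X) (acs X c (k z)) (mat_app 2 ?K v) a"
    using assms(3) z a by (simp add: M holo_rep_def flip: assms(2)[OF z])
qed

lemma holo_rep_local:
  assumes "\<And>z. z \<in> S \<Longrightarrow> \<exists>V. open V \<and> z \<in> V \<and> V \<subseteq> S \<and> holo_rep X c V h"
  shows "holo_rep X c S h"
proof -
  have "Ck_on 2 k (real_vec ` S) (\<lambda>x. chart X c (h (of_vec x)) a)" if "a < mdim X" for a k
  proof (rule Ck_on_local)
    fix x assume "x \<in> real_vec ` S"
    then obtain z where z: "z \<in> S" "x = real_vec z" by blast
    obtain V where V: "open V" "z \<in> V" "V \<subseteq> S" "holo_rep X c V h"
      using assms[OF z(1)] by blast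
    have "real_vec ` V = real_vec ` S \<inter> of_vec -` V" using V(3) by auto
    moreover have "open (of_vec -` V)"
      using V(1) continuous_of_vec[of UNIV] by (simp add: continuous_on_open_vimage)
    ultimately have "openin (top_of_set (real_vec ` S)) (real_vec ` V)"
      by (metis openin_open)
    then show "\<exists>V. openin (top_of_set (real_vec ` S)) V \<and> x \<in> V \<and>
        Ck_on 2 k V (\<lambda>x. chart X c (h (of_vec x)) a)"
      using V(2,4) that z(2) unfolding holo_rep_def smooth_on_def by blast
  qed
  then show ?thesis
    unfolding holo_rep_def smooth_on_def using assms[unfolded holo_rep_def] by blast
qed

lemma holo_rep_compose:
  assumes "open S" "open V" "m holomorphic_on V" "m ` V \<subseteq> S" "holo_rep X c S h"
  shows "holo_rep X c V (\<lambda>z. h (m z))"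
  unfolding holo_rep_def
proof (intro conjI allI impI ballI)
  have C: "Ck_on 2 k (real_vec ` S) (\<lambda>x. chart X c (h (of_vec x)) a)" if "a < mdim X" for a k
    using assms(5) that by (simp add: holo_rep_def smooth_on_def)
  show "smooth_on 2 (real_vec ` V) (\<lambda>x. chart X c (h (m (of_vec x))) a)" if "a < mdim X" for a
    using Ck_on_compose_holomorphic[OF assms(1-4) C[OF that]] by (simp add: smooth_on_def)
  fix z v a assume z: "z \<in> V" and a: "a < mdim X"
  let ?H = "jacobian (\<lambda>x. chart X c (h (of_vec x))) (real_vec (m z))"
  let ?K = "jacobian (\<lambda>x. chart X c (h (m (of_vec x)))) (real_vec z)"
  let ?J = "\<lambda>v k::nat. if k = 0 then - v 1 else v 0"
  define w where "w v = real_vec (deriv m z * Complex (v 0) (v (Suc 0)))" for v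
  have M: "mat_app 2 ?K v a = mat_app 2 ?H (w v) a" if "a < mdim X" for v a
  proof -
    have "(m has_field_derivative deriv m z) (at z)"
      using assms(3,2) z by (rule holomorphic_derivI)
    with has_derivative_real_vec_compose[OF assms(1) C[OF that]] assms(4) z
    have "((\<lambda>w. chart X c (h (m w)) a) has_derivative
      (\<lambda>h. ?H a 0 * Re (deriv m z * h) + ?H a (Suc 0) * Im (deriv m z * h))) (at z)"
      by (auto simp: jacobian_def)
    from partial_deriv_of_vec[OF this]
    have e: "?K a 0 = ?H a 0 * Re (deriv m z) + ?H a (Suc 0) * Im (deriv m z)"
      and e': "?K a (Suc 0) = ?H a (Suc 0) * Re (deriv m z) - ?H a 0 * Im (deriv m z)"
      by (simp_all add: jacobian_def)
    show ?thesis
      unfolding mat_app_2 e e' by (simp add: w_def real_vec_simps algebra_simps)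
  qed
  have "mat_app 2 ?K (?J v) a = mat_app 2 ?H (?J (w v)) a"
    unfolding M[OF a] by (simp add: mat_app_2 w_def real_vec_simps algebra_simps)
  also have "\<dots> = mat_app (mdim X) (acs X c (h (m z))) (mat_app 2 ?H (w v)) a"
  proof -
    have "m z \<in> S" using assms(4) z by blast
    then show ?thesis using assms(5) a unfolding holo_rep_def by blast
  qed
  also have "\<dots> = mat_app (mdim X) (acs X c (h (m z))) (mat_app 2 ?K v) a"
    by (rule mat_app_cong) (simp_all add: M)
  finally show "mat_app 2 ?K (?J v) a = mat_app (mdim X) (acs X c (h (m z))) (mat_app 2 ?K v) a" .
qed

lemma pholo_chart_iff_holo_rep:
  fixes Z :: "('z, 'k) ac_mfd" and q :: "complex \<Rightarrow> 'z"
  assumes dim: "mdim Z = 2" and q: "cdom Z c = range q" "range q \<subseteq> points Z"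
    and chart: "\<And>z. chart Z c (q z) = real_vec z"
    and acs: "\<And>z v. mat_app 2 (acs Z c (q z)) v 0 = - v 1" "\<And>z v. mat_app 2 (acs Z c (q z)) v 1 = v 0"
    and op: "open {z. f (q z) \<in> cdom X c'}"
  defines "W \<equiv> {p \<in> points Z \<inter> cdom Z c. f p \<in> cdom X c'}"
  shows "(\<forall>a<mdim X. smooth_on (mdim Z) (chart Z c ` W) (\<lambda>x. coord_rep Z X c c' f x a)) \<and>
     (\<forall>p\<in>W. \<forall>v. \<forall>a<mdim X.
        mat_app (mdim Z) (jacobian (coord_rep Z X c c' f) (chart Z c p))
          (mat_app (mdim Z) (acs Z c p) v) a =
        mat_app (mdim X) (acs X c' (f p))
          (mat_app (mdim Z) (jacobian (coord_rep Z X c c' f) (chart Z c p)) v) a) \<longleftrightarrow>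
     holo_rep X c' {z. f (q z) \<in> cdom X c'} (\<lambda>z. f (q z))"
proof -
  let ?S = "{z. f (q z) \<in> cdom X c'}"
  have W: "W = q ` ?S" unfolding W_def q(1) using q(2) by auto
  have cW: "chart Z c ` W = real_vec ` ?S" unfolding W by (auto simp: chart image_iff)
  have "inj_on (chart Z c) (range q)"
    by (rule inj_onI) (metis chart of_vec_real_vec rangeE)
  then have cinv: "cinv Z c (real_vec z) = q z" for z
    unfolding cinv_def q(1) by (metis chart inv_into_f_f rangeI)
  have rep: "coord_rep Z X c c' f (real_vec z) = chart X c' (f (q z))" for z
    by (simp add: coord_rep_def cinv)
  have smooth: "smooth_on 2 (real_vec ` ?S) (\<lambda>x. coord_rep Z X c c' f x a) \<longleftrightarrow>
      smooth_on 2 (real_vec ` ?S) (\<lambda>x. chart X c' (f (q (of_vec x))) a)" for a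
    by (rule iffI; erule smooth_on_cong[OF openin_real_vec_image[OF op], rotated]) (auto simp: rep)
  have jac: "mat_app 2 (jacobian (coord_rep Z X c c' f) (real_vec z)) v =
      mat_app 2 (jacobian (\<lambda>x. chart X c' (f (q (of_vec x)))) (real_vec z)) v" for z v
    by (intro ext mat_app_cong jacobian_cong[OF open_UNIV]) (simp_all add: rep)
  have J: "mat_app 2 A (mat_app 2 (acs Z c (q z)) v) a = mat_app 2 A (\<lambda>k. if k = 0 then - v 1 else v 0) a"
    for A z v a
    using acs[of z v] by (simp add: mat_app_2)
  show ?thesis
    unfolding holo_rep_def dim cW smooth unfolding W by (simp add: chart jac J)
qed

section \<open>Spheres and projective transformations\<close>

definition CP1_pt :: "bool \<Rightarrow> complex \<Rightarrow> (complex \<times> complex) set" where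
  "CP1_pt c z = (if c then hpoint 1 z else hpoint z 1)"

lemma hpoint_scale:
  assumes "s \<noteq> 0"
  shows "hpoint (s * a) (s * b) = hpoint a b"
proof
  show "hpoint (s * a) (s * b) \<subseteq> hpoint a b"
    unfolding hpoint_def using assms by (auto simp flip: mult.assoc)
  show "hpoint a b \<subseteq> hpoint (s * a) (s * b)"
  proof
    fix x assume "x \<in> hpoint a b"
    then obtain t where "t \<noteq> 0" "x = (t * a, t * b)" by (auto simp: hpoint_def)
    then have "t / s \<noteq> 0" "x = ((t / s) * (s * a), (t / s) * (s * b))" using assms by auto
    then show "x \<in> hpoint (s * a) (s * b)" unfolding hpoint_def by blast
  qed
qed

lemma self_in_hpoint: "(a, b) \<in> hpoint a b"
  unfolding hpoint_def by (simp add: exI[of _ 1])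

lemma hpoint_eq_if_mem: "(x, y) \<in> hpoint a b \<Longrightarrow> hpoint x y = hpoint a b"
  by (auto simp: hpoint_def[of a b] hpoint_scale)

lemma CP1_points_eq_hpoint: "\<lbrakk>P \<in> CP1_points; (x, y) \<in> P\<rbrakk> \<Longrightarrow> P = hpoint x y"
  using hpoint_eq_if_mem by (auto simp: CP1_points_def)

lemma hpoint_in_CP1_points: "(a, b) \<noteq> (0, 0) \<Longrightarrow> hpoint a b \<in> CP1_points"
  unfolding CP1_points_def by blast

lemma Union_CP1_points: "\<Union>CP1_points = - {(0, 0)}"
proof (intro equalityI subsetI)
  show "v \<in> - {(0, 0)}" if "v \<in> \<Union>CP1_points" for v
    using that by (auto simp: CP1_points_def hpoint_def)
  show "v \<in> \<Union>CP1_points" if "v \<in> - {(0, 0)}" for v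
    using that self_in_hpoint[of "fst v" "snd v"] hpoint_in_CP1_points[of "fst v" "snd v"] by auto
qed

lemma mem_Union_CP1_iff: "U \<subseteq> CP1_points \<Longrightarrow> (x, y) \<in> \<Union>U \<longleftrightarrow> hpoint x y \<in> U"
  by (auto dest: CP1_points_eq_hpoint intro: self_in_hpoint)

lemma topspace_CP1_top [simp]: "topspace CP1_top = CP1_points"
proof -
  have "openin CP1_top CP1_points"
    unfolding openin_CP1_top Union_CP1_points by (simp add: open_Compl)
  then show ?thesis
    by (metis openin_CP1_top openin_subset openin_topspace subset_antisym)
qed

lemma points_CP1 [simp]: "points CP1 = CP1_points" and mtop_CP1 [simp]: "mtop CP1 = CP1_top"
  by (simp_all add: CP1_def)

lemma CP1_coord_CP1_pt [simp]: "CP1_coord c (CP1_pt c z) = z"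
  unfolding CP1_coord_def CP1_pt_def hpoint_def by (auto intro!: the_equality)

lemma cdom_CP1: "cdom CP1 c = range (CP1_pt c)"
proof (cases c)
  case True
  have "hpoint z0 z1 \<in> range (hpoint 1)" if "z0 \<noteq> 0" for z0 z1
    using hpoint_scale[OF that, of 1 "z1 / z0"] that by auto
  then show ?thesis using True by (auto simp: CP1_def CP1_pt_def)
next
  case False
  have "hpoint z0 z1 \<in> range (\<lambda>z. hpoint z 1)" if "z1 \<noteq> 0" for z0 z1
    using hpoint_scale[OF that, of "z0 / z1" 1] that by auto
  then show ?thesis using False by (auto simp: CP1_def CP1_pt_def) (metis one_neq_zero)
qed

lemma CP1_pt_in_points: "CP1_pt c z \<in> CP1_points"
  unfolding CP1_pt_def by (cases c) (simp_all add: hpoint_in_CP1_points)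

lemma chart_CP1: "chart CP1 c (CP1_pt c z) = real_vec z"
  by (rule ext) (simp add: CP1_def real_vec_def)

lemma acs_CP1: "mat_app 2 (acs CP1 c P) v 0 = - v 1" "mat_app 2 (acs CP1 c P) v 1 = v 0"
  by (simp_all add: CP1_def mat_app_2)

lemma continuous_map_into_CP1:
  assumes "continuous_on (topspace (top_of_set S)) g" "\<And>x. x \<in> S \<Longrightarrow> g x \<noteq> (0, 0)"
  shows "continuous_map (top_of_set S) CP1_top (\<lambda>x. hpoint (fst (g x)) (snd (g x)))"
  unfolding continuous_map_def
proof (intro conjI allI impI)
  show "(\<lambda>x. hpoint (fst (g x)) (snd (g x))) \<in> topspace (top_of_set S) \<rightarrow> topspace CP1_top"
    using assms(2) by (auto simp: CP1_points_def) (metis prod.collapse)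
  fix U assume U: "openin CP1_top U"
  have "{x \<in> topspace (top_of_set S). hpoint (fst (g x)) (snd (g x)) \<in> U} = S \<inter> g -` (\<Union>U)"
    using mem_Union_CP1_iff[of U] U unfolding openin_CP1_top by (auto simp flip: mem_Union_CP1_iff)
  then show "openin (top_of_set S) {x \<in> topspace (top_of_set S). hpoint (fst (g x)) (snd (g x)) \<in> U}"
    using assms(1) U by (simp add: openin_CP1_top continuous_openin_preimage_gen)
qed

lemma continuous_map_CP1_pt: "continuous_map euclidean CP1_top (CP1_pt c)"
proof (cases c)
  case True
  show ?thesis
    using continuous_map_into_CP1[of UNIV "\<lambda>z. (1, z)"] True
    by (simp add: CP1_pt_def[abs_def] continuous_intros)
next
  case False
  show ?thesis
    using continuous_map_into_CP1[of UNIV "\<lambda>z. (z, 1)"] False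
    by (simp add: CP1_pt_def[abs_def] continuous_intros)
qed

lemma connected_space_CP1: "connected_space CP1_top"
proof -
  have "connected (- {(0, 0) :: complex \<times> complex})"
    by (rule connected_punctured_universe) simp
  then have "connectedin (top_of_set (- {(0, 0)})) (- {(0, 0) :: complex \<times> complex})"
    by (simp add: connectedin_subtopology)
  from connectedin_continuous_map_image[OF continuous_map_into_CP1[of "- {(0, 0)}" id] this]
  have "connectedin CP1_top ((\<lambda>x. hpoint (fst x) (snd x)) ` (- {(0, 0)}))" by simp
  moreover have "(\<lambda>x. hpoint (fst x) (snd x)) ` (- {(0, 0)}) = CP1_points"
    by (force simp: CP1_points_def)
  ultimately show ?thesis
    by (simp flip: connectedin_topspace)
qed

lemma open_CP1_preimage:
  assumes "compatible_ac_manifold X" "c' \<in> atlas X" "continuous_map CP1_top (mtop X) f"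
  shows "open {z. f (CP1_pt c z) \<in> cdom X c'}"
proof -
  interpret compatible_ac_manifold X by fact
  have "continuous_map euclidean (mtop X) (f \<circ> CP1_pt c)"
    using continuous_map_CP1_pt assms(3) by (rule continuous_map_compose)
  then have "openin euclidean {z \<in> topspace euclidean. (f \<circ> CP1_pt c) z \<in> cdom X c'}"
    using cdom_open[OF assms(2)] by (rule openin_continuous_map_preimage)
  then show ?thesis by simp
qed

lemma pholo_CP1_iff:
  assumes "compatible_ac_manifold X"
  shows "pholo CP1 X f \<longleftrightarrow> continuous_map CP1_top (mtop X) f \<and>
    (\<forall>c. \<forall>c'\<in>atlas X. holo_rep X c' {z. f (CP1_pt c z) \<in> cdom X c'} (\<lambda>z. f (CP1_pt c z)))"
proof (cases "continuous_map CP1_top (mtop X) f")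
  case True
  have dim: "mdim CP1 = 2" and at: "atlas CP1 = UNIV" by (simp_all add: CP1_def)
  have pts: "range (CP1_pt c) \<subseteq> points CP1" for c by (auto intro: CP1_pt_in_points)
  note iff = pholo_chart_iff_holo_rep[OF dim cdom_CP1 pts chart_CP1 acs_CP1
      open_CP1_preimage[OF assms _ True]]
  have sub: "subtopology CP1_top CP1_points = CP1_top"
    by (metis subtopology_topspace topspace_CP1_top)
  show ?thesis
    unfolding pholo_on_def Let_def at mtop_CP1 topspace_CP1_top sub
    using iff[unfolded points_CP1] True by simp
next
  case False
  have sub: "subtopology CP1_top CP1_points = CP1_top"
    by (metis subtopology_topspace topspace_CP1_top)
  show ?thesis using False unfolding pholo_on_def mtop_CP1 topspace_CP1_top sub by simp
qed

lemma mtop_prod_mfd: "mtop (prod_mfd M N) = prod_topology (mtop M) (mtop N)"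
  and mtop_power_mfd: "mtop (power_mfd M n) = product_topology (\<lambda>_. mtop M) {..<n}"
  by (simp_all add: prod_mfd_def power_mfd_def)

abbreviation pt_CP1 :: "nat \<Rightarrow> (unit \<times> (nat \<Rightarrow> (complex \<times> complex) set), unit \<times> (nat \<Rightarrow> bool)) ac_mfd" where
  "pt_CP1 n \<equiv> prod_mfd pt_mfd (power_mfd CP1 n)"

lemma pholo_pt_CP1:
  assumes X: "compatible_ac_manifold X" and f: "pholo CP1 X f"
  shows "pholo (pt_CP1 1) X (\<lambda>y. f (snd y 0))"
proof -
  have f1: "continuous_map CP1_top (mtop X) f"
    and f2: "\<And>c c'. c' \<in> atlas X \<Longrightarrow>
      holo_rep X c' {z. f (CP1_pt c z) \<in> cdom X c'} (\<lambda>z. f (CP1_pt c z))"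
    using pholo_CP1_iff[OF X, THEN iffD1, OF f] by simp_all
  have cont: "continuous_map (mtop (pt_CP1 1)) (mtop X) (\<lambda>y. f (snd y 0))"
  proof -
    have "continuous_map (mtop (pt_CP1 1)) CP1_top ((\<lambda>x. x 0) \<circ> snd)"
      unfolding mtop_prod_mfd mtop_power_mfd mtop_CP1
      by (intro continuous_map_compose[OF continuous_map_snd] continuous_map_product_projection) simp
    from continuous_map_compose[OF this f1] show ?thesis by (simp add: o_def)
  qed
  have dim: "mdim (pt_CP1 1) = 2" by (simp add: prod_mfd_def power_mfd_def pt_mfd_def CP1_def)
  define q where "q c z = ((), \<lambda>l\<in>{..<1::nat}. CP1_pt c z)" for c z
  have cdom: "cdom (pt_CP1 1) c = range (q (snd c 0))" for c
  proof -
    have "\<exists>z. x = (\<lambda>l\<in>{..<1}. CP1_pt (snd c 0) z)"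
      if x: "x \<in> (\<Pi>\<^sub>E l\<in>{..<1}. range (CP1_pt (snd c l)))" for x :: "nat \<Rightarrow> (complex \<times> complex) set"
    proof -
      have "x 0 \<in> range (CP1_pt (snd c 0))" using PiE_mem[OF x, of 0] by simp
      then obtain z where "x 0 = CP1_pt (snd c 0) z" by blast
      then have "x = (\<lambda>l\<in>{..<1}. CP1_pt (snd c 0) z)"
        using x by (intro extensionalityI[of _ "{..<1}"]) (auto simp: PiE_def)
      then show ?thesis ..
    qed
    then have "(\<Pi>\<^sub>E l\<in>{..<1}. range (CP1_pt (snd c l))) = range (\<lambda>z. \<lambda>l\<in>{..<1}. CP1_pt (snd c 0) z)"
      by (intro equalityI subsetI) (blast, auto)
    moreover have "cdom (pt_CP1 1) c = UNIV \<times> (\<Pi>\<^sub>E l\<in>{..<1}. range (CP1_pt (snd c l)))"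
      by (cases c) (simp add: prod_mfd_def power_mfd_def pt_mfd_def cdom_CP1)
    ultimately show ?thesis by (auto simp: q_def)
  qed
  have pts: "range (q c) \<subseteq> points (pt_CP1 1)" for c
    by (auto simp: q_def prod_mfd_def power_mfd_def pt_mfd_def CP1_pt_in_points)
  have chart: "chart (pt_CP1 1) c (q (snd c 0) z) = real_vec z" for c z
  proof
    have "chart CP1 (snd c 0) (CP1_pt (snd c 0) z) k = real_vec z k" for k by (simp add: chart_CP1)
    then show "chart (pt_CP1 1) c (q (snd c 0) z) k = real_vec z k" for k
      by (cases c) (auto simp: prod_mfd_def power_mfd_def pt_mfd_def q_def CP1_def real_vec_def)
  qed
  have acs: "mat_app 2 (acs (pt_CP1 1) c (q c' z)) v 0 = - v 1"
    "mat_app 2 (acs (pt_CP1 1) c (q c' z)) v 1 = v 0" for c c' z v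
    by (cases c; simp add: mat_app_2 prod_mfd_def power_mfd_def pt_mfd_def q_def CP1_def
        block_sum_def block_power_def)+
  have q0: "snd (q c z) 0 = CP1_pt c z" for c z by (simp add: q_def)
  have sub: "subtopology (mtop (pt_CP1 1)) (points (pt_CP1 1)) = mtop (pt_CP1 1)"
    by (rule subtopology_topspace)
  show ?thesis
    unfolding pholo_on_def Let_def sub
  proof (intro conjI[OF cont] ballI)
    fix c c' assume c': "c' \<in> atlas X"
    show "(\<forall>a<mdim X. smooth_on (mdim (pt_CP1 1)) (chart (pt_CP1 1) c `
           {p \<in> points (pt_CP1 1) \<inter> cdom (pt_CP1 1) c. f (snd p 0) \<in> cdom X c'})
           (\<lambda>x. coord_rep (pt_CP1 1) X c c' (\<lambda>y. f (snd y 0)) x a)) \<and>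
        (\<forall>p\<in>{p \<in> points (pt_CP1 1) \<inter> cdom (pt_CP1 1) c. f (snd p 0) \<in> cdom X c'}. \<forall>v. \<forall>a<mdim X.
           mat_app (mdim (pt_CP1 1)) (jacobian (coord_rep (pt_CP1 1) X c c' (\<lambda>y. f (snd y 0)))
               (chart (pt_CP1 1) c p)) (mat_app (mdim (pt_CP1 1)) (acs (pt_CP1 1) c p) v) a =
           mat_app (mdim X) (acs X c' (f (snd p 0)))
             (mat_app (mdim (pt_CP1 1)) (jacobian (coord_rep (pt_CP1 1) X c c' (\<lambda>y. f (snd y 0)))
               (chart (pt_CP1 1) c p)) v) a)"
      by (subst pholo_chart_iff_holo_rep[OF dim cdom pts chart acs])
         (use f2[OF c'] open_CP1_preimage[OF X c' f1] in \<open>simp_all add: q0\<close>)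
  qed
qed

definition lin2 :: "complex \<Rightarrow> complex \<Rightarrow> complex \<Rightarrow> complex \<Rightarrow> complex \<times> complex \<Rightarrow> complex \<times> complex" where
  "lin2 a0 a1 b0 b1 = (\<lambda>(x, y). (b0 * x + a0 * y, b1 * x + a1 * y))"

lemma lin2_image_hpoint:
  "lin2 a0 a1 b0 b1 ` hpoint x y = hpoint (b0 * x + a0 * y) (b1 * x + a1 * y)"
proof -
  have "lin2 a0 a1 b0 b1 (t * x, t * y) = (t * (b0 * x + a0 * y), t * (b1 * x + a1 * y))" for t
    by (simp add: lin2_def algebra_simps)
  then show ?thesis unfolding hpoint_def by (auto simp: image_iff) metis+
qed

lemma lin2_nonzero:
  assumes "b0 * a1 - a0 * b1 \<noteq> 0" "(x, y) \<noteq> (0, 0)"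
  shows "lin2 a0 a1 b0 b1 (x, y) \<noteq> (0, 0)"
proof
  assume "lin2 a0 a1 b0 b1 (x, y) = (0, 0)"
  then have eq: "b0 * x + a0 * y = 0" "b1 * x + a1 * y = 0" by (auto simp: lin2_def)
  have "(b0 * a1 - a0 * b1) * x = a1 * (b0 * x + a0 * y) - a0 * (b1 * x + a1 * y)"
    "(b0 * a1 - a0 * b1) * y = b0 * (b1 * x + a1 * y) - b1 * (b0 * x + a0 * y)"
    by (simp_all add: algebra_simps)
  with eq assms show False by simp
qed

lemma continuous_map_lin2:
  assumes "b0 * a1 - a0 * b1 \<noteq> 0"
  shows "continuous_map CP1_top CP1_top (image (lin2 a0 a1 b0 b1))"
  unfolding continuous_map_def
proof (intro conjI allI impI)
  let ?A = "lin2 a0 a1 b0 b1"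
  show "image ?A \<in> topspace CP1_top \<rightarrow> topspace CP1_top"
  proof
    fix P assume "P \<in> topspace CP1_top"
    then obtain x y where P: "P = hpoint x y" "(x, y) \<noteq> (0, 0)"
      unfolding topspace_CP1_top CP1_points_def by blast
    from lin2_nonzero[OF assms P(2)] show "?A ` P \<in> topspace CP1_top"
      unfolding P(1) lin2_image_hpoint topspace_CP1_top
      by (intro hpoint_in_CP1_points) (simp add: lin2_def)
  qed
  fix U assume U: "openin CP1_top U"
  then have sub: "U \<subseteq> CP1_points" and op: "open (\<Union>U)" by (simp_all add: openin_CP1_top)
  have "continuous_on UNIV ?A"
    unfolding lin2_def case_prod_unfold by (intro continuous_intros)
  then have "open (?A -` \<Union>U)" using op by (simp add: continuous_on_open_vimage)
  moreover have "\<Union>{P \<in> topspace CP1_top. ?A ` P \<in> U} = ?A -` \<Union>U"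
  proof (intro equalityI subsetI)
    fix v assume "v \<in> \<Union>{P \<in> topspace CP1_top. ?A ` P \<in> U}"
    then show "v \<in> ?A -` \<Union>U" by blast
  next
    fix v assume v: "v \<in> ?A -` \<Union>U"
    obtain x y where xy: "v = (x, y)" by (cases v)
    have A: "?A v = (b0 * x + a0 * y, b1 * x + a1 * y)" by (simp add: xy lin2_def)
    have "?A v \<in> \<Union>CP1_points" using v sub by blast
    then have "(x, y) \<noteq> (0, 0)" unfolding Union_CP1_points A by auto
    then have "hpoint x y \<in> CP1_points" by (auto simp: CP1_points_def)
    moreover have "?A ` hpoint x y \<in> U"
      unfolding lin2_image_hpoint using v mem_Union_CP1_iff[OF sub] by (simp add: A)
    ultimately show "v \<in> \<Union>{P \<in> topspace CP1_top. ?A ` P \<in> U}"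
      using self_in_hpoint[of x y] by (auto simp: xy)
  qed
  ultimately show "openin CP1_top {P \<in> topspace CP1_top. ?A ` P \<in> U}"
    unfolding openin_CP1_top by auto
qed

lemma pholo_CP1_lin2:
  assumes X: "compatible_ac_manifold X" and f: "pholo CP1 X f" and det: "b0 * a1 - a0 * b1 \<noteq> 0"
  shows "pholo CP1 X (\<lambda>P. f (lin2 a0 a1 b0 b1 ` P))"
proof -
  let ?A = "lin2 a0 a1 b0 b1" and ?g = "\<lambda>P. f (lin2 a0 a1 b0 b1 ` P)"
  have f1: "continuous_map CP1_top (mtop X) f"
    and f2: "\<And>c c'. c' \<in> atlas X \<Longrightarrow>
      holo_rep X c' {z. f (CP1_pt c z) \<in> cdom X c'} (\<lambda>z. f (CP1_pt c z))"
    using pholo_CP1_iff[OF X, THEN iffD1, OF f] by simp_all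
  have cont: "continuous_map CP1_top (mtop X) ?g"
    using continuous_map_compose[OF continuous_map_lin2[OF det] f1] by (simp add: o_def)
  have "holo_rep X c' {z. ?g (CP1_pt c z) \<in> cdom X c'} (\<lambda>z. ?g (CP1_pt c z))"
    if c': "c' \<in> atlas X" for c c'
  proof (rule holo_rep_local)
    fix z assume z: "z \<in> {z. ?g (CP1_pt c z) \<in> cdom X c'}"
    let ?S = "{z. ?g (CP1_pt c z) \<in> cdom X c'}"
    define n0 where "n0 w = (if c then b0 + a0 * w else b0 * w + a0)" for w
    define n1 where "n1 w = (if c then b1 + a1 * w else b1 * w + a1)" for w
    have A: "?A ` CP1_pt c w = hpoint (n0 w) (n1 w)" for w
      by (simp add: CP1_pt_def lin2_image_hpoint n0_def n1_def)
    have "(n0 w, n1 w) \<noteq> (0, 0)" for w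
      using lin2_nonzero[OF det, of 1 w] lin2_nonzero[OF det, of w 1]
      by (auto simp: lin2_def n0_def n1_def split: if_splits)
    then obtain e where e: "(if e then n0 else n1) z \<noteq> 0" by (metis (full_types))
    define D where "D = (if e then n0 else n1)"
    define m where "m w = (if e then n1 w / n0 w else n0 w / n1 w)" for w
    define V where "V = ?S \<inter> {w. D w \<noteq> 0}"
    have AD: "?A ` CP1_pt c w = CP1_pt e (m w)" if "D w \<noteq> 0" for w
    proof (cases e)
      case True
      then show ?thesis
        using that hpoint_scale[of "n0 w" 1 "n1 w / n0 w"] unfolding A by (simp add: CP1_pt_def m_def D_def)
    next
      case False
      then show ?thesis
        using that hpoint_scale[of "n1 w" "n0 w / n1 w" 1] unfolding A by (simp add: CP1_pt_def m_def D_def)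
    qed
    have n: "n0 holomorphic_on T" "n1 holomorphic_on T" for T
      unfolding n0_def n1_def by (cases c; simp; intro holomorphic_intros)+
    then have "continuous_on UNIV D"
      unfolding D_def using holomorphic_on_imp_continuous_on by auto
    then have "open (D -` (- {0}))" by (simp add: continuous_on_open_vimage open_Compl)
    then have "open {w. D w \<noteq> 0}" by (simp add: vimage_def)
    then have "open V"
      unfolding V_def by (intro open_Int open_CP1_preimage[OF X c' cont])
    have m: "m holomorphic_on V"
      unfolding m_def V_def D_def by (cases e; simp; intro holomorphic_intros n; simp)
    have "m ` V \<subseteq> {z. f (CP1_pt e z) \<in> cdom X c'}"
      unfolding V_def using AD by auto
    from holo_rep_compose[OF open_CP1_preimage[OF X c' f1] \<open>open V\<close> m this f2[OF c']]
    have "holo_rep X c' V (\<lambda>z. f (CP1_pt e (m z)))" .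
    then have "holo_rep X c' V (\<lambda>z. ?g (CP1_pt c z))"
      by (rule holo_rep_cong[OF \<open>open V\<close>, rotated]) (simp add: AD V_def)
    moreover have "z \<in> V" "V \<subseteq> ?S" using z e by (auto simp: V_def D_def)
    ultimately show "\<exists>V. open V \<and> z \<in> V \<and> V \<subseteq> ?S \<and> holo_rep X c' V (\<lambda>z. ?g (CP1_pt c z))"
      using \<open>open V\<close> by blast
  qed
  then show ?thesis using cont pholo_CP1_iff[OF X] by blast
qed

lemma pholo_CP1_through:
  assumes X: "compatible_ac_manifold X" and f: "pholo CP1 X f"
    and P: "P \<in> CP1_points" and Q: "Q \<in> CP1_points" and "P \<noteq> Q"
  obtains g where "pholo CP1 X g" "g (hpoint 0 1) = f P" "g (hpoint 1 0) = f Q"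
proof -
  obtain a0 a1 b0 b1 where a: "P = hpoint a0 a1" "(a0, a1) \<noteq> (0, 0)"
    and b: "Q = hpoint b0 b1" "(b0, b1) \<noteq> (0, 0)"
    using P Q unfolding CP1_points_def by blast
  have "b0 * a1 - a0 * b1 \<noteq> 0"
  proof
    assume det: "b0 * a1 - a0 * b1 = 0"
    have "\<exists>s. s \<noteq> 0 \<and> (b0, b1) = (s * a0, s * a1)"
    proof (cases "a0 = 0")
      case True
      then show ?thesis using det a(2) b(2) by (intro exI[of _ "b1 / a1"]) auto
    next
      case False
      then show ?thesis using det b(2)
        by (intro exI[of _ "b0 / a0"]) (auto simp: field_simps)
    qed
    then have "P = Q" unfolding a(1) b(1) using hpoint_scale by auto
    with \<open>P \<noteq> Q\<close> show False by contradiction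
  qed
  from pholo_CP1_lin2[OF X f this] show thesis
    by (rule that) (simp_all add: lin2_image_hpoint a b)
qed

section \<open>The Grothendieck group of a commutative monoid\<close>

locale groth_monoid = comm_monoid G for G :: "'a monoid" (structure)
begin

lemma equiv_groth_rel: "equiv (carrier G \<times> carrier G) (groth_rel G)"
proof (rule equivI)
  show "groth_rel G \<subseteq> (carrier G \<times> carrier G) \<times> carrier G \<times> carrier G"
    by (auto simp: groth_rel_def)
  show "refl_on (carrier G \<times> carrier G) (groth_rel G)"
    by (auto simp: refl_on_def groth_rel_def)
  show "sym (groth_rel G)"
    by (rule symI) (auto simp: groth_rel_def, metis)
  show "trans (groth_rel G)"
  proof (rule transI)
    fix x y z assume "(x, y) \<in> groth_rel G" "(y, z) \<in> groth_rel G"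
    then obtain a b c d e f k l where xyz: "x = (a, b)" "y = (c, d)" "z = (e, f)"
      and [simp]: "a \<in> carrier G" "b \<in> carrier G" "c \<in> carrier G" "d \<in> carrier G"
        "e \<in> carrier G" "f \<in> carrier G" "k \<in> carrier G" "l \<in> carrier G"
      and k: "a \<otimes> d \<otimes> k = c \<otimes> b \<otimes> k" and l: "c \<otimes> f \<otimes> l = e \<otimes> d \<otimes> l"
      unfolding groth_rel_def by auto
    have "a \<otimes> f \<otimes> (d \<otimes> k \<otimes> l) = (a \<otimes> d \<otimes> k) \<otimes> (f \<otimes> l)" by (simp add: m_ac)
    also have "\<dots> = (c \<otimes> f \<otimes> l) \<otimes> (b \<otimes> k)" unfolding k by (simp add: m_ac)
    also have "\<dots> = e \<otimes> b \<otimes> (d \<otimes> k \<otimes> l)" unfolding l by (simp add: m_ac)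
    finally have "a \<otimes> f \<otimes> (d \<otimes> k \<otimes> l) = e \<otimes> b \<otimes> (d \<otimes> k \<otimes> l)" .
    then show "(x, z) \<in> groth_rel G"
      unfolding xyz groth_rel_def by (auto intro!: bexI[of _ "d \<otimes> k \<otimes> l"])
  qed
qed

abbreviation gclass :: "'a \<Rightarrow> 'a \<Rightarrow> ('a \<times> 'a) set" where
  "gclass a b \<equiv> groth_rel G `` {(a, b)}"

lemma gclass_self: "\<lbrakk>a \<in> carrier G; b \<in> carrier G\<rbrakk> \<Longrightarrow> (a, b) \<in> gclass a b"
  by (auto simp: groth_rel_def)

lemma gclass_eqI:
  "\<lbrakk>a \<in> carrier G; b \<in> carrier G; c \<in> carrier G; d \<in> carrier G; a \<otimes> d = c \<otimes> b\<rbrakk>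
    \<Longrightarrow> gclass a b = gclass c d"
  by (rule equiv_class_eq[OF equiv_groth_rel]) (auto simp: groth_rel_def)

lemma groth_carrierI: "\<lbrakk>a \<in> carrier G; b \<in> carrier G\<rbrakk> \<Longrightarrow> gclass a b \<in> carrier (groth G)"
  by (simp add: groth_def quotientI)

lemma groth_carrierE:
  assumes "z \<in> carrier (groth G)"
  obtains a b where "a \<in> carrier G" "b \<in> carrier G" "z = gclass a b"
  using assms by (auto simp: groth_def elim!: quotientE)

lemma groth_UN:
  assumes "a \<in> carrier G" "b \<in> carrier G"
    and "\<And>c d k. \<lbrakk>c \<in> carrier G; d \<in> carrier G; k \<in> carrier G; a \<otimes> d \<otimes> k = c \<otimes> b \<otimes> k\<rbrakk> \<Longrightarrow> F a b = F c d"
  shows "(\<Union>(c, d)\<in>gclass a b. F c d) = F a b"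
proof -
  have "F c d = F a b" if "(c, d) \<in> gclass a b" for c d
    using that assms(3)[of c d] by (auto simp: groth_rel_def)
  then have "(\<Union>x\<in>gclass a b. case x of (c, d) \<Rightarrow> F c d) = (case (a, b) of (c, d) \<Rightarrow> F c d)"
    by (intro UN_constant_eq[OF gclass_self[OF assms(1,2)]]) auto
  then show ?thesis by simp
qed

lemma groth_mult:
  assumes [simp]: "a \<in> carrier G" "b \<in> carrier G" "c \<in> carrier G" "d \<in> carrier G"
  shows "gclass a b \<otimes>\<^bsub>groth G\<^esub> gclass c d = gclass (a \<otimes> c) (b \<otimes> d)"
proof -
  have eq: "gclass (a \<otimes> c) (b \<otimes> d) = gclass (a' \<otimes> c') (b' \<otimes> d')"
    if [simp]: "a' \<in> carrier G" "b' \<in> carrier G" "c' \<in> carrier G" "d' \<in> carrier G"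
      "a \<in> carrier G" "b \<in> carrier G" "c \<in> carrier G" "d \<in> carrier G" "k \<in> carrier G" "l \<in> carrier G"
      and k: "a \<otimes> b' \<otimes> k = a' \<otimes> b \<otimes> k" and l: "c \<otimes> d' \<otimes> l = c' \<otimes> d \<otimes> l"
    for a b c d a' b' c' d' k l
  proof (rule equiv_class_eq[OF equiv_groth_rel])
    have "a \<otimes> c \<otimes> (b' \<otimes> d') \<otimes> (k \<otimes> l) = (a \<otimes> b' \<otimes> k) \<otimes> (c \<otimes> d' \<otimes> l)"
      by (simp add: m_ac)
    also have "\<dots> = a' \<otimes> c' \<otimes> (b \<otimes> d) \<otimes> (k \<otimes> l)"
      unfolding k l by (simp add: m_ac)
    finally show "((a \<otimes> c, b \<otimes> d), (a' \<otimes> c', b' \<otimes> d')) \<in> groth_rel G"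
      by (auto simp: groth_rel_def intro!: bexI[of _ "k \<otimes> l"])
  qed
  have inner: "(\<Union>(c', d')\<in>gclass c d. gclass (a \<otimes> c') (b \<otimes> d')) = gclass (a \<otimes> c) (b \<otimes> d)"
    if [simp]: "a \<in> carrier G" "b \<in> carrier G" for a b
  proof (rule groth_UN)
    show "gclass (a \<otimes> c) (b \<otimes> d) = gclass (a \<otimes> c') (b \<otimes> d')"
      if "c' \<in> carrier G" "d' \<in> carrier G" "k \<in> carrier G" "c \<otimes> d' \<otimes> k = c' \<otimes> d \<otimes> k" for c' d' k
      by (rule eq[where k = \<one> and l = k]) (use that in \<open>simp_all add: m_comm\<close>)
  qed simp_all
  have "gclass a b \<otimes>\<^bsub>groth G\<^esub> gclass c d =
      (\<Union>(a', b')\<in>gclass a b. \<Union>(c', d')\<in>gclass c d. gclass (a' \<otimes> c') (b' \<otimes> d'))"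
    by (simp add: groth_def)
  also have "\<dots> = (\<Union>(c', d')\<in>gclass c d. gclass (a \<otimes> c') (b \<otimes> d'))"
  proof (rule groth_UN)
    fix a' b' k assume *: "a' \<in> carrier G" "b' \<in> carrier G" "k \<in> carrier G" "a \<otimes> b' \<otimes> k = a' \<otimes> b \<otimes> k"
    then show "(\<Union>(c', d')\<in>gclass c d. gclass (a \<otimes> c') (b \<otimes> d')) =
        (\<Union>(c', d')\<in>gclass c d. gclass (a' \<otimes> c') (b' \<otimes> d'))"
      using eq[where a = a and b = b and a' = a' and b' = b' and c = c and d = d and c' = c and d' = d
          and k = k and l = \<one>]
      by (simp add: inner)
  qed simp_all
  also have "\<dots> = gclass (a \<otimes> c) (b \<otimes> d)" by (rule inner) simp_all
  finally show ?thesis .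
qed

lemma groth_one: "\<one>\<^bsub>groth G\<^esub> = gclass \<one> \<one>"
  by (simp add: groth_def)

lemma comm_group_groth: "comm_group (groth G)"
proof (rule comm_groupI)
  fix x y z assume "x \<in> carrier (groth G)" "y \<in> carrier (groth G)" "z \<in> carrier (groth G)"
  then obtain a b c d e f where
    [simp]: "a \<in> carrier G" "b \<in> carrier G" "c \<in> carrier G" "d \<in> carrier G" "e \<in> carrier G" "f \<in> carrier G"
    and xyz: "x = gclass a b" "y = gclass c d" "z = gclass e f"
    by (metis groth_carrierE)
  show "x \<otimes>\<^bsub>groth G\<^esub> y \<otimes>\<^bsub>groth G\<^esub> z = x \<otimes>\<^bsub>groth G\<^esub> (y \<otimes>\<^bsub>groth G\<^esub> z)"
    unfolding xyz by (simp add: groth_mult m_assoc)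
next
  fix x y assume "x \<in> carrier (groth G)" "y \<in> carrier (groth G)"
  then obtain a b c d where
    [simp]: "a \<in> carrier G" "b \<in> carrier G" "c \<in> carrier G" "d \<in> carrier G"
    and xy: "x = gclass a b" "y = gclass c d"
    by (metis groth_carrierE)
  show "x \<otimes>\<^bsub>groth G\<^esub> y \<in> carrier (groth G)"
    unfolding xy by (simp add: groth_mult groth_carrierI)
  show "x \<otimes>\<^bsub>groth G\<^esub> y = y \<otimes>\<^bsub>groth G\<^esub> x"
    unfolding xy by (simp add: groth_mult m_comm)
next
  show "\<one>\<^bsub>groth G\<^esub> \<in> carrier (groth G)"
    by (simp add: groth_one groth_carrierI)
next
  fix x assume "x \<in> carrier (groth G)"
  then obtain a b where [simp]: "a \<in> carrier G" "b \<in> carrier G" and x: "x = gclass a b"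
    by (metis groth_carrierE)
  show "\<one>\<^bsub>groth G\<^esub> \<otimes>\<^bsub>groth G\<^esub> x = x"
    unfolding x by (simp add: groth_mult groth_one)
  show "\<exists>y\<in>carrier (groth G). y \<otimes>\<^bsub>groth G\<^esub> x = \<one>\<^bsub>groth G\<^esub>"
    unfolding x groth_one
    by (rule bexI[of _ "gclass b a"])
       (simp add: groth_mult, rule gclass_eqI, simp_all add: m_comm groth_carrierI)
qed

lemma groth_inv:
  assumes [simp]: "a \<in> carrier G" "b \<in> carrier G"
  shows "inv\<^bsub>groth G\<^esub> (gclass a b) = gclass b a"
proof -
  interpret GG: comm_group "groth G" by (rule comm_group_groth)
  show ?thesis
    by (rule GG.inv_equality)
       (simp add: groth_mult groth_one, rule gclass_eqI, simp_all add: m_comm groth_carrierI)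
qed

lemma groth_map_gclass:
  assumes H: "groth_monoid H" and h: "h \<in> hom G H" and a [simp]: "a \<in> carrier G" and b [simp]: "b \<in> carrier G"
  shows "groth_map H h (gclass a b) = groth_rel H `` {(h a, h b)}"
proof -
  interpret H: groth_monoid H by fact
  have [simp]: "x \<in> carrier G \<Longrightarrow> h x \<in> carrier H" for x using h by (auto simp: hom_def)
  have mult: "x \<in> carrier G \<Longrightarrow> y \<in> carrier G \<Longrightarrow> h (x \<otimes> y) = h x \<otimes>\<^bsub>H\<^esub> h y" for x y
    using h by (simp add: hom_mult)
  show ?thesis
    unfolding groth_map_def
  proof (rule groth_UN[OF a b])
    fix c d k
    assume [simp]: "c \<in> carrier G" "d \<in> carrier G" "k \<in> carrier G" and "a \<otimes> d \<otimes> k = c \<otimes> b \<otimes> k"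
    then have "h (a \<otimes> d \<otimes> k) = h (c \<otimes> b \<otimes> k)" by simp
    then have "((h a, h b), (h c, h d)) \<in> groth_rel H"
      unfolding groth_rel_def by (auto simp: mult intro!: bexI[of _ "h k"])
    then show "groth_rel H `` {(h a, h b)} = groth_rel H `` {(h c, h d)}"
      by (rule equiv_class_eq[OF H.equiv_groth_rel])
  qed
qed

definition groth_lift :: "('a \<Rightarrow> int) \<Rightarrow> ('a \<times> 'a) set \<Rightarrow> int" where
  "groth_lift \<phi> A = the_elem ((\<lambda>(a, b). \<phi> a - \<phi> b) ` A)"

lemma groth_lift_gclass:
  assumes "\<phi> \<in> hom G integer_group" and a: "a \<in> carrier G" and b: "b \<in> carrier G"
  shows "groth_lift \<phi> (gclass a b) = \<phi> a - \<phi> b"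
proof -
  have mult: "x \<in> carrier G \<Longrightarrow> y \<in> carrier G \<Longrightarrow> \<phi> (x \<otimes> y) = \<phi> x + \<phi> y" for x y
    using hom_mult[OF assms(1)] by simp
  have "\<phi> c - \<phi> d = \<phi> a - \<phi> b" if "(c, d) \<in> gclass a b" for c d
  proof -
    from that obtain k where [simp]: "c \<in> carrier G" "d \<in> carrier G" "k \<in> carrier G"
      and "a \<otimes> d \<otimes> k = c \<otimes> b \<otimes> k"
      by (auto simp: groth_rel_def)
    then have "\<phi> (a \<otimes> d \<otimes> k) = \<phi> (c \<otimes> b \<otimes> k)" by simp
    then show ?thesis using a b by (simp add: mult)
  qed
  then have "(\<lambda>(c, d). \<phi> c - \<phi> d) ` gclass a b = (\<lambda>_. \<phi> a - \<phi> b) ` gclass a b"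
    by (intro image_cong refl) (simp only: split_paired_all prod.case)
  also have "\<dots> = {\<phi> a - \<phi> b}"
    using gclass_self[OF a b] by (rule image_constant)
  finally show ?thesis by (simp add: groth_lift_def)
qed

lemma groth_lift_hom:
  assumes "\<phi> \<in> hom G integer_group"
  shows "groth_lift \<phi> \<in> hom (groth G) integer_group"
proof (rule homI)
  fix x y assume "x \<in> carrier (groth G)" "y \<in> carrier (groth G)"
  then obtain a b c d where
    [simp]: "a \<in> carrier G" "b \<in> carrier G" "c \<in> carrier G" "d \<in> carrier G"
    and xy: "x = gclass a b" "y = gclass c d"
    by (metis groth_carrierE)
  show "groth_lift \<phi> (x \<otimes>\<^bsub>groth G\<^esub> y) = groth_lift \<phi> x \<otimes>\<^bsub>integer_group\<^esub> groth_lift \<phi> y"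
    unfolding xy using hom_mult[OF assms] by (simp add: groth_mult groth_lift_gclass[OF assms])
qed simp

end

section \<open>Sections of the sheaf of correspondences\<close>

lemma pholo_on_subset:
  assumes "pholo_on Y X U f" "V \<subseteq> U"
  shows "pholo_on Y X V f"
  unfolding pholo_on_def Let_def
proof (intro conjI ballI)
  show "continuous_map (subtopology (mtop Y) V) (mtop X) f"
    using assms by (auto simp: pholo_on_def intro: continuous_map_from_subtopology_mono)
next
  fix c c' assume c: "c \<in> atlas Y" "c' \<in> atlas X"
  let ?W = "\<lambda>U. {p \<in> U \<inter> cdom Y c. f p \<in> cdom X c'}"
  have U: "(\<forall>a<mdim X. smooth_on (mdim Y) (chart Y c ` ?W U) (\<lambda>x. coord_rep Y X c c' f x a)) \<and>
    (\<forall>p\<in>?W U. \<forall>v. \<forall>a<mdim X.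
           mat_app (mdim Y) (jacobian (coord_rep Y X c c' f) (chart Y c p))
             (mat_app (mdim Y) (acs Y c p) v) a =
           mat_app (mdim X) (acs X c' (f p))
             (mat_app (mdim Y) (jacobian (coord_rep Y X c c' f) (chart Y c p)) v) a)"
    using assms(1) c unfolding pholo_on_def Let_def by blast
  have "?W V \<subseteq> ?W U" using assms(2) by blast
  then have "chart Y c ` ?W V \<subseteq> chart Y c ` ?W U" by (rule image_mono)
  with U have "\<forall>a<mdim X. smooth_on (mdim Y) (chart Y c ` ?W V) (\<lambda>x. coord_rep Y X c c' f x a)"
    by (meson smooth_on_subset)
  then show "\<forall>a<mdim X. smooth_on (mdim Y) (chart Y c ` ?W V) (\<lambda>x. coord_rep Y X c c' f x a)" .
  show "\<forall>v. \<forall>a<mdim X. mat_app (mdim Y) (jacobian (coord_rep Y X c c' f) (chart Y c p))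
             (mat_app (mdim Y) (acs Y c p) v) a =
           mat_app (mdim X) (acs X c' (f p))
             (mat_app (mdim Y) (jacobian (coord_rep Y X c c' f) (chart Y c p)) v) a"
    if "p \<in> ?W V" for p
    using U that assms(2) by blast
qed

lemma partial_deriv_const: "partial_deriv i (\<lambda>_. c) = (\<lambda>_. 0)"
  by (simp add: partial_deriv_def fun_eq_iff)

lemma Ck_on_const: "Ck_on d k U (\<lambda>_. c)"
  by (induction k arbitrary: c) (simp_all add: partial_deriv_const)

lemma pholo_const:
  assumes "p \<in> points X"
  shows "pholo_on Y X U (\<lambda>_. p)"
proof -
  have "jacobian (coord_rep Y X c c' (\<lambda>_. p)) x = (\<lambda>_ _. 0)" for c c' x
    by (simp add: fun_eq_iff jacobian_def coord_rep_def partial_deriv_const)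
  moreover have "mat_app d (\<lambda>_ _. 0) v = (\<lambda>_. 0)" "mat_app d A (\<lambda>_. 0) = (\<lambda>_. 0)" for d A v
    by (simp_all add: mat_app_def fun_eq_iff)
  moreover have "smooth_on d V (\<lambda>x. coord_rep Y X c c' (\<lambda>_. p) x a)" for d V c c' a
    by (simp add: smooth_on_def coord_rep_def Ck_on_const)
  ultimately show ?thesis
    unfolding pholo_on_def Let_def using assms by simp
qed

lemma JCor_simps [simp]:
  "s \<otimes>\<^bsub>JCor Y X\<^esub> t = (\<lambda>y. s y + t y)" "\<one>\<^bsub>JCor Y X\<^esub> = (\<lambda>_. {#})"
  by (simp_all add: JCor_def)

lemma sec_restrict_restrict [simp]: "sec_restrict U (sec_restrict V s) = sec_restrict (U \<inter> V) s"
  by (auto simp: sec_restrict_def fun_eq_iff)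

lemma carrier_JCor_iff:
  "s \<in> carrier (JCor Y X) \<longleftrightarrow> sec_restrict (points Y) s = s \<and>
    (\<forall>y\<in>points Y. \<exists>V fs. openin (mtop Y) V \<and> y \<in> V \<and> (\<forall>f\<in>set fs. pholo_on Y X V f) \<and>
       (\<forall>z\<in>V. s z = mset (map (\<lambda>f. f z) fs)))" (is "_ \<longleftrightarrow> _ \<and> (\<forall>y\<in>points Y. ?P y)")
proof -
  have tuples: "sec_restrict V s \<in> tuples n Y X V \<longleftrightarrow>
      (\<exists>fs. length fs = n \<and> (\<forall>f\<in>set fs. pholo_on Y X V f) \<and> (\<forall>z\<in>V. s z = mset (map (\<lambda>f. f z) fs)))" for n V
    unfolding tuples_def by (auto simp: sec_restrict_def fun_eq_iff)
  have P: "?P y \<longleftrightarrow> (\<exists>V n. openin (mtop Y) V \<and> y \<in> V \<and> sec_restrict V s \<in> tuples n Y X V)" for y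
    unfolding tuples by blast
  have "(\<exists>V. openin (mtop Y) V \<and> y \<in> V \<and> V \<subseteq> points Y \<and> sec_restrict V s \<in> (\<Union>n. JCor_n n Y X V)) \<longleftrightarrow> ?P y" for y
  proof
    assume "\<exists>V. openin (mtop Y) V \<and> y \<in> V \<and> V \<subseteq> points Y \<and> sec_restrict V s \<in> (\<Union>n. JCor_n n Y X V)"
    then obtain V n where V: "y \<in> V" "sec_restrict V s \<in> JCor_n n Y X V" by blast
    then obtain V' where "openin (mtop Y) V'" "y \<in> V'" "V' \<subseteq> V"
      "sec_restrict V' (sec_restrict V s) \<in> tuples n Y X V'"
      unfolding JCor_n_def sheafification_def by blast
    then show "?P y" unfolding P by (metis sec_restrict_restrict inf.absorb1)
  next
    assume "?P y"
    then obtain V n where "openin (mtop Y) V" "y \<in> V" "sec_restrict V s \<in> tuples n Y X V"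
      unfolding P by blast
    then show "\<exists>V. openin (mtop Y) V \<and> y \<in> V \<and> V \<subseteq> points Y \<and> sec_restrict V s \<in> (\<Union>n. JCor_n n Y X V)"
      unfolding JCor_n_def sheafification_def
      by (intro exI[of _ V]) (auto dest: openin_subset intro!: exI[of _ n] exI[of _ V])
  qed
  then show ?thesis
    unfolding JCor_def sheafification_def by simp
qed

lemma JCorI:
  assumes "\<forall>f\<in>set fs. pholo Y X f"
  shows "sec_restrict (points Y) (\<lambda>y. mset (map (\<lambda>f. f y) fs)) \<in> carrier (JCor Y X)"
  unfolding carrier_JCor_iff
proof (intro conjI ballI)
  fix y assume "y \<in> points Y"
  then show "\<exists>V gs. openin (mtop Y) V \<and> y \<in> V \<and> (\<forall>f\<in>set gs. pholo_on Y X V f) \<and>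
      (\<forall>z\<in>V. sec_restrict (points Y) (\<lambda>y. mset (map (\<lambda>f. f y) fs)) z = mset (map (\<lambda>f. f z) gs))"
    by (intro exI[of _ "points Y"] exI[of _ fs]) (simp add: assms sec_restrict_def)
qed simp

lemma JCor_outside: "\<lbrakk>s \<in> carrier (JCor Y X); y \<notin> points Y\<rbrakk> \<Longrightarrow> s y = {#}"
  by (simp add: carrier_JCor_iff) (metis sec_restrict_def)

lemma JCor_values:
  assumes "s \<in> carrier (JCor Y X)" "y \<in> points Y"
  shows "set_mset (s y) \<subseteq> points X"
proof -
  obtain V fs where V: "openin (mtop Y) V" "y \<in> V" "\<forall>f\<in>set fs. pholo_on Y X V f" "s y = mset (map (\<lambda>f. f y) fs)"
    using assms unfolding carrier_JCor_iff by meson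
  have "f y \<in> points X" if "f \<in> set fs" for f
  proof -
    have "continuous_map (subtopology (mtop Y) V) (mtop X) f"
      using V(3) that by (simp add: pholo_on_def)
    then show ?thesis
      using V(2) assms(2) by (auto simp: continuous_map_def Pi_iff)
  qed
  then show ?thesis unfolding V(4) by auto
qed

lemma JCor_size_const:
  assumes s: "s \<in> carrier (JCor Y X)" and "connected_space (mtop Y)" and yz: "y \<in> points Y" "z \<in> points Y"
  shows "size (s y) = size (s z)"
proof -
  have op: "openin (mtop Y) {x \<in> points Y. Q (size (s x))}" for Q
  proof (subst openin_subopen, intro ballI)
    fix x assume x: "x \<in> {x \<in> points Y. Q (size (s x))}"
    then have "x \<in> points Y" by simp
    then obtain V fs where V: "openin (mtop Y) V" "x \<in> V" "\<forall>w\<in>V. s w = mset (map (\<lambda>f. f w) fs)"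
      using s unfolding carrier_JCor_iff by meson
    then have "V \<subseteq> {x \<in> points Y. Q (size (s x))}"
      using x openin_subset[OF V(1)] by auto
    then show "\<exists>T. openin (mtop Y) T \<and> x \<in> T \<and> T \<subseteq> {x \<in> points Y. Q (size (s x))}"
      using V by blast
  qed
  let ?T = "{x \<in> points Y. size (s x) = size (s z)}"
  have "points Y - ?T = {x \<in> points Y. size (s x) \<noteq> size (s z)}" by auto
  then have "closedin (mtop Y) ?T" using op[of "\<lambda>n. n \<noteq> size (s z)"] by (simp add: closedin_def)
  with op[of "\<lambda>n. n = size (s z)"] have "?T = {} \<or> ?T = points Y"
    by (intro assms(2)[unfolded connected_space_clopen_in, rule_format] conjI)
  then show ?thesis using yz by blast
qed

lemma groth_monoid_JCor: "groth_monoid (JCor Y X)"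
proof (intro groth_monoid.intro comm_monoidI)
  fix s t assume s: "s \<in> carrier (JCor Y X)" and t: "t \<in> carrier (JCor Y X)"
  show "s \<otimes>\<^bsub>JCor Y X\<^esub> t \<in> carrier (JCor Y X)"
    unfolding carrier_JCor_iff JCor_simps
  proof (intro conjI ballI)
    show "sec_restrict (points Y) (\<lambda>y. s y + t y) = (\<lambda>y. s y + t y)"
      using JCor_outside[OF s] JCor_outside[OF t] by (auto simp: sec_restrict_def)
    fix y assume y: "y \<in> points Y"
    obtain V fs where V: "openin (mtop Y) V" "y \<in> V" "\<forall>f\<in>set fs. pholo_on Y X V f"
        "\<forall>z\<in>V. s z = mset (map (\<lambda>f. f z) fs)"
      using s y unfolding carrier_JCor_iff by meson
    obtain W gs where W: "openin (mtop Y) W" "y \<in> W" "\<forall>f\<in>set gs. pholo_on Y X W f"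
        "\<forall>z\<in>W. t z = mset (map (\<lambda>f. f z) gs)"
      using t y unfolding carrier_JCor_iff by meson
    show "\<exists>V fs. openin (mtop Y) V \<and> y \<in> V \<and> (\<forall>f\<in>set fs. pholo_on Y X V f) \<and>
       (\<forall>z\<in>V. s z + t z = mset (map (\<lambda>f. f z) fs))"
      using V W by (intro exI[of _ "V \<inter> W"] exI[of _ "fs @ gs"]) (auto intro: pholo_on_subset)
  qed
next
  show "\<one>\<^bsub>JCor Y X\<^esub> \<in> carrier (JCor Y X)"
    using JCorI[of "[]" Y X] by (simp add: sec_restrict_def)
qed (auto simp: ac_simps)

section \<open>The homology in degree zero\<close>

abbreviation base_pt :: "unit \<times> (nat \<Rightarrow> (complex \<times> complex) set)" where
  "base_pt \<equiv> ((), \<lambda>_. undefined)"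

abbreviation line_pt :: "(complex \<times> complex) set \<Rightarrow> unit \<times> (nat \<Rightarrow> (complex \<times> complex) set)" where
  "line_pt P \<equiv> ((), \<lambda>k\<in>{..<1}. P)"

lemma points_pt_CP1_0: "points (pt_CP1 0) = {base_pt}"
  by (auto simp: prod_mfd_def power_mfd_def pt_mfd_def)

lemma line_pt_in_points: "P \<in> CP1_points \<Longrightarrow> line_pt P \<in> points (pt_CP1 1)"
  by (simp add: prod_mfd_def power_mfd_def pt_mfd_def)

lemma insert_at_base: "map_prod id (insert_at 1 0 P) base_pt = line_pt P"
  by (auto simp: insert_at_def fun_eq_iff)

lemma connected_pt_CP1: "connected_space (mtop (pt_CP1 n))"
  by (simp add: mtop_prod_mfd mtop_power_mfd connected_space_prod_topology
      connected_space_product_topology connected_space_CP1 pt_mfd_def connected_space_discrete_topology UNIV_unit)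

lemma JCor_const:
  assumes "set_mset A \<subseteq> points X"
  shows "sec_restrict (points Y) (\<lambda>_. A) \<in> carrier (JCor Y X)"
proof -
  obtain ps where ps: "mset ps = A" by (metis ex_mset)
  have "\<forall>f\<in>set (map (\<lambda>p _. p) ps). pholo Y X f"
    using assms ps by (auto intro: pholo_const)
  from JCorI[OF this] show ?thesis by (simp add: ps comp_def)
qed

lemma JCor_pt_CP1_0_iff:
  "s \<in> carrier (JCor (pt_CP1 0) X) \<longleftrightarrow>
    s = sec_restrict {base_pt} (\<lambda>_. s base_pt) \<and> set_mset (s base_pt) \<subseteq> points X"
proof
  assume s: "s \<in> carrier (JCor (pt_CP1 0) X)"
  have "s = sec_restrict {base_pt} (\<lambda>_. s base_pt)"
  proof
    show "s y = sec_restrict {base_pt} (\<lambda>_. s base_pt) y" for y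
      using JCor_outside[OF s, of y] unfolding sec_restrict_def points_pt_CP1_0
      by (cases "y = base_pt") (simp_all only: singleton_iff if_True if_False simp_thms)
  qed
  then show "s = sec_restrict {base_pt} (\<lambda>_. s base_pt) \<and> set_mset (s base_pt) \<subseteq> points X"
    using JCor_values[OF s] by (simp add: points_pt_CP1_0)
next
  assume "s = sec_restrict {base_pt} (\<lambda>_. s base_pt) \<and> set_mset (s base_pt) \<subseteq> points X"
  then show "s \<in> carrier (JCor (pt_CP1 0) X)"
    using JCor_const[of "s base_pt" X "pt_CP1 0"] by (simp add: points_pt_CP1_0)
qed

definition restrict_to_pt :: "(complex \<times> complex) set \<Rightarrow> (unit \<times> (nat \<Rightarrow> (complex \<times> complex) set) \<Rightarrow> 'x multiset) \<Rightarrow>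
    unit \<times> (nat \<Rightarrow> (complex \<times> complex) set) \<Rightarrow> 'x multiset" where
  "restrict_to_pt P s = sec_restrict (points (pt_CP1 0)) (s \<circ> map_prod id (insert_at 1 0 P))"

lemma restrict_to_pt_base: "restrict_to_pt P s base_pt = s (line_pt P)"
  using insert_at_base[of P] by (simp add: restrict_to_pt_def sec_restrict_def points_pt_CP1_0)

lemma restrict_to_pt_hom:
  assumes "P \<in> CP1_points"
  shows "restrict_to_pt P \<in> hom (JCor (pt_CP1 1) X) (JCor (pt_CP1 0) X)"
proof (rule homI)
  fix s t assume s: "s \<in> carrier (JCor (pt_CP1 1) X)"
  have "restrict_to_pt P s = sec_restrict {base_pt} (\<lambda>_. s (line_pt P))"
  proof
    show "restrict_to_pt P s y = sec_restrict {base_pt} (\<lambda>_. s (line_pt P)) y" for y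
      using insert_at_base[of P] unfolding restrict_to_pt_def sec_restrict_def points_pt_CP1_0 o_def
      by (cases "y = base_pt") (simp_all only: singleton_iff if_True if_False simp_thms)
  qed
  then show "restrict_to_pt P s \<in> carrier (JCor (pt_CP1 0) X)"
    unfolding JCor_pt_CP1_0_iff restrict_to_pt_base
    using JCor_values[OF s line_pt_in_points[OF assms]] by blast
  show "restrict_to_pt P (s \<otimes>\<^bsub>JCor (pt_CP1 1) X\<^esub> t) =
      restrict_to_pt P s \<otimes>\<^bsub>JCor (pt_CP1 0) X\<^esub> restrict_to_pt P t"
    by (auto simp: restrict_to_pt_def sec_restrict_def)
qed

lemma degree_hom: "(\<lambda>s. int (size (s base_pt))) \<in> hom (JCor (pt_CP1 0) X) integer_group"
  by (rule homI) simp_all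

lemma section_through:
  fixes X :: "('x, 'i) ac_mfd"
  assumes X: "compatible_ac_manifold X"
    and conn: "\<forall>p\<in>points X. \<forall>q\<in>points X. \<exists>f. pholo CP1 X f \<and> p \<in> f ` points CP1 \<and> q \<in> f ` points CP1"
    and A: "set_mset A \<subseteq> points X" and B: "set_mset B \<subseteq> points X" and size: "size A = size B"
  obtains s where "s \<in> carrier (JCor (pt_CP1 1) X)"
    "s (line_pt (hpoint 0 1)) = A" "s (line_pt (hpoint 1 0)) = B"
proof -
  let ?e0 = "line_pt (hpoint 0 1)" and ?e1 = "line_pt (hpoint 1 0)"
  have "\<exists>g. pholo (pt_CP1 1) X g \<and> g ?e0 = p \<and> g ?e1 = q" if p: "p \<in> points X" and q: "q \<in> points X" for p q
  proof (cases "p = q")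
    case True
    then show ?thesis using pholo_const[OF p] by blast
  next
    case False
    obtain f P Q where f: "pholo CP1 X f" and PQ: "P \<in> CP1_points" "Q \<in> CP1_points" "p = f P" "q = f Q"
      using conn[rule_format, OF p q] unfolding points_CP1 by blast
    with False have "P \<noteq> Q" by blast
    obtain g where g: "pholo CP1 X g" "g (hpoint 0 1) = f P" "g (hpoint 1 0) = f Q"
      by (rule pholo_CP1_through[OF X f PQ(1,2) \<open>P \<noteq> Q\<close>])
    show ?thesis
      by (rule exI[of _ "\<lambda>y. g (snd y 0)"]) (use pholo_pt_CP1[OF X g(1)] g(2,3) PQ in simp)
  qed
  then obtain G where G: "\<And>p q. \<lbrakk>p \<in> points X; q \<in> points X\<rbrakk> \<Longrightarrow>
      pholo (pt_CP1 1) X (G p q) \<and> G p q ?e0 = p \<and> G p q ?e1 = q"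
    by metis
  obtain ps qs where ps: "mset ps = A" and qs: "mset qs = B" by (metis ex_mset)
  have len: "length ps = length qs" using size by (simp flip: ps qs)
  define fs where "fs = map (\<lambda>(p, q). G p q) (zip ps qs)"
  define s where "s = sec_restrict (points (pt_CP1 1)) (\<lambda>y. mset (map (\<lambda>f. f y) fs))"
  have mem: "p \<in> points X" "q \<in> points X" if "(p, q) \<in> set (zip ps qs)" for p q
    using set_zip_leftD[OF that] set_zip_rightD[OF that] A B by (auto simp flip: ps qs)
  show thesis
  proof
    show "s \<in> carrier (JCor (pt_CP1 1) X)"
      unfolding s_def by (rule JCorI) (auto simp: fs_def G mem simp del: One_nat_def)
    have "map (\<lambda>f. f ?e0) fs = map fst (zip ps qs)" "map (\<lambda>f. f ?e1) fs = map snd (zip ps qs)"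
      unfolding fs_def using G mem by auto
    then have e: "mset (map (\<lambda>f. f ?e0) fs) = A" "mset (map (\<lambda>f. f ?e1) fs) = B"
      using len ps qs by simp_all
    have "?e0 \<in> points (pt_CP1 1)" "?e1 \<in> points (pt_CP1 1)"
      by (intro line_pt_in_points hpoint_in_CP1_points; simp)+
    then show "s ?e0 = A" "s ?e1 = B"
      unfolding s_def sec_restrict_def using e by simp_all
  qed
qed

lemma JC_diff_gclass:
  fixes X :: "('x, 'i) ac_mfd"
  assumes s: "s \<in> carrier (JCor (pt_CP1 1) X)" and t: "t \<in> carrier (JCor (pt_CP1 1) X)"
    and P: "P \<in> CP1_points" and Q: "Q \<in> CP1_points"
  shows "JC_diff CP1 P Q 1 pt_mfd X (groth_rel (JCor (pt_CP1 1) X) `` {(s, t)}) =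
    groth_rel (JCor (pt_CP1 0) X) ``
      {(\<lambda>y. restrict_to_pt P s y + restrict_to_pt Q t y, \<lambda>y. restrict_to_pt P t y + restrict_to_pt Q s y)}"
proof -
  interpret Z0: groth_monoid "JCor (pt_CP1 0) X" by (rule groth_monoid_JCor)
  interpret Z1: groth_monoid "JCor (pt_CP1 1) X" by (rule groth_monoid_JCor)
  interpret C0: comm_group "groth (JCor (pt_CP1 0) X)" by (rule Z0.comm_group_groth)
  have cl: "restrict_to_pt R u \<in> carrier (JCor (pt_CP1 0) X)"
    if "R \<in> CP1_points" "u \<in> carrier (JCor (pt_CP1 1) X)" for R u
    using restrict_to_pt_hom[OF that(1)] that(2) by (rule hom_in_carrier)
  let ?z = "groth_rel (JCor (pt_CP1 1) X) `` {(s, t)}"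
  have face: "face CP1 P Q 1 pt_mfd X 0 \<epsilon> ?z =
      Z0.gclass (restrict_to_pt (if \<epsilon> = 0 then P else Q) s) (restrict_to_pt (if \<epsilon> = 0 then P else Q) t)" for \<epsilon>
  proof -
    have "(if \<epsilon> = 0 then P else Q) \<in> CP1_points" using P Q by simp
    from Z1.groth_map_gclass[OF Z0.groth_monoid_axioms restrict_to_pt_hom[OF this] s t]
    show ?thesis
      unfolding face_def JC_pullback_def restrict_to_pt_def[abs_def] by simp
  qed
  have carr: "face CP1 P Q 1 pt_mfd X 0 \<epsilon> ?z \<in> carrier (groth (JCor (pt_CP1 0) X))" for \<epsilon>
    unfolding face by (rule Z0.groth_carrierI) (simp_all add: cl s t P Q del: One_nat_def)
  have "JC_diff CP1 P Q 1 pt_mfd X ?z =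
      face CP1 P Q 1 pt_mfd X 0 0 ?z \<otimes>\<^bsub>groth (JCor (pt_CP1 0) X)\<^esub>
      inv\<^bsub>groth (JCor (pt_CP1 0) X)\<^esub> face CP1 P Q 1 pt_mfd X 0 1 ?z"
    using carr unfolding JC_diff_def JC_M_def JC_def
    by (simp add: C0.int_pow_neg lessThan_Suc)
  also have "\<dots> = Z0.gclass (restrict_to_pt P s) (restrict_to_pt P t)
      \<otimes>\<^bsub>groth (JCor (pt_CP1 0) X)\<^esub> Z0.gclass (restrict_to_pt Q t) (restrict_to_pt Q s)"
    unfolding face by (simp add: Z0.groth_inv cl s t P Q del: One_nat_def)
  also have "\<dots> = Z0.gclass (\<lambda>y. restrict_to_pt P s y + restrict_to_pt Q t y)
      (\<lambda>y. restrict_to_pt P t y + restrict_to_pt Q s y)"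
    by (subst Z0.groth_mult) (simp_all add: cl s t P Q del: One_nat_def)
  finally show ?thesis .
qed

theorem lemma2p3:
  fixes X :: "('x, 'i) ac_mfd"
  assumes "compatible_ac_manifold X"
    and "\<forall>p\<in>points X. \<forall>q\<in>points X. \<exists>f. pholo CP1 X f \<and> p \<in> f ` points CP1 \<and> q \<in> f ` points CP1"
  shows "JH CP1 (hpoint 0 1) (hpoint 1 0) 0 pt_mfd X \<cong> integer_group"
proof -
  let ?Z0 = "JCor (pt_CP1 0) X" and ?Z1 = "JCor (pt_CP1 1) X"
  let ?P = "hpoint 0 1" and ?Q = "hpoint 1 0"
  let ?d = "JC_diff CP1 ?P ?Q 1 pt_mfd X"
  interpret Z0: groth_monoid ?Z0 by (rule groth_monoid_JCor)
  interpret Z1: groth_monoid ?Z1 by (rule groth_monoid_JCor)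
  interpret C0: comm_group "groth ?Z0" by (rule Z0.comm_group_groth)
  define \<phi> :: "(unit \<times> (nat \<Rightarrow> (complex \<times> complex) set) \<Rightarrow> 'x multiset) \<Rightarrow> int"
    where "\<phi> s = int (size (s base_pt))" for s
  have \<phi>: "\<phi> \<in> hom ?Z0 integer_group"
    unfolding \<phi>_def[abs_def] by (rule degree_hom)
  define deg where "deg = Z0.groth_lift \<phi>"
  have deg: "deg (Z0.gclass a b) = \<phi> a - \<phi> b" if "a \<in> carrier ?Z0" "b \<in> carrier ?Z0" for a b
    unfolding deg_def using \<phi> that by (rule Z0.groth_lift_gclass)
  interpret deg: group_hom "groth ?Z0" integer_group deg
    by (intro group_hom.intro group_hom_axioms.intro C0.is_group group_integer_group)
       (simp add: deg_def Z0.groth_lift_hom[OF \<phi>])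
  have P: "?P \<in> CP1_points" and Q: "?Q \<in> CP1_points" by (simp_all add: hpoint_in_CP1_points)
  have cl: "restrict_to_pt R u \<in> carrier ?Z0" if "R \<in> CP1_points" "u \<in> carrier ?Z1" for R u
    using restrict_to_pt_hom[OF that(1)] that(2) by (rule hom_in_carrier)
  have const: "sec_restrict {base_pt} (\<lambda>_. A) \<in> carrier ?Z0" if "set_mset A \<subseteq> points X" for A
    using JCor_const[OF that, of "pt_CP1 0"] by (simp add: points_pt_CP1_0)
  have surj: "deg ` carrier (groth ?Z0) = carrier integer_group"
  proof (intro equalityI subsetI)
    fix n :: int assume "n \<in> carrier integer_group"
    obtain p where p: "p \<in> points X"
      using smooth_manifold.nonempty[of X] assms(1)
      unfolding compatible_ac_manifold_def symplectic_manifold_def by blast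
    let ?s = "\<lambda>k. sec_restrict {base_pt} (\<lambda>_. replicate_mset k p)"
    have s: "?s k \<in> carrier ?Z0" for k by (rule const) (use p in \<open>auto split: if_splits\<close>)
    have "deg (Z0.gclass (?s (nat n)) (?s (nat (- n)))) = n"
      by (subst deg[OF s s]) (simp add: \<phi>_def sec_restrict_def)
    then show "n \<in> deg ` carrier (groth ?Z0)"
      using Z0.groth_carrierI[OF s s] by (metis image_eqI)
  qed simp
  have im: "?d ` carrier (groth ?Z1) = kernel (groth ?Z0) integer_group deg"
  proof (intro equalityI subsetI)
    fix w assume "w \<in> ?d ` carrier (groth ?Z1)"
    then obtain z where z: "z \<in> carrier (groth ?Z1)" and "w = ?d z" by blast
    from z obtain s t where s: "s \<in> carrier ?Z1" and t: "t \<in> carrier ?Z1" and "z = Z1.gclass s t"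
      by (rule Z1.groth_carrierE)
    with \<open>w = ?d z\<close> have w: "w = ?d (Z1.gclass s t)" by simp
    have add: "(\<lambda>y. restrict_to_pt R u y + restrict_to_pt R' v y) \<in> carrier ?Z0"
      if "R \<in> CP1_points" "u \<in> carrier ?Z1" "R' \<in> CP1_points" "v \<in> carrier ?Z1" for R u R' v
      using Z0.m_closed[OF cl[OF that(1,2)] cl[OF that(3,4)]] by simp
    have size: "size (u (line_pt ?P)) = size (u (line_pt ?Q))" if "u \<in> carrier ?Z1" for u
      using that connected_pt_CP1 line_pt_in_points[OF P] line_pt_in_points[OF Q] by (rule JCor_size_const)
    have "deg w = 0"
      unfolding w JC_diff_gclass[OF s t P Q]
      by (subst deg) (simp_all add: add s t P Q \<phi>_def restrict_to_pt_base size del: One_nat_def)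
    moreover have "w \<in> carrier (groth ?Z0)"
      unfolding w JC_diff_gclass[OF s t P Q] by (intro Z0.groth_carrierI add s t P Q)
    ultimately show "w \<in> kernel (groth ?Z0) integer_group deg" by (simp add: kernel_def)
  next
    fix w assume "w \<in> kernel (groth ?Z0) integer_group deg"
    then have wc: "w \<in> carrier (groth ?Z0)" and w0: "deg w = 0" by (simp_all add: kernel_def)
    from wc obtain a b where a: "a \<in> carrier ?Z0" and b: "b \<in> carrier ?Z0" and w: "w = Z0.gclass a b"
      by (rule Z0.groth_carrierE)
    have "set_mset (a base_pt) \<subseteq> points X" "set_mset (b base_pt) \<subseteq> points X"
      using a b by (simp_all add: JCor_pt_CP1_0_iff)
    moreover have "size (a base_pt) = size (b base_pt)"
      using w0 unfolding w by (simp add: deg a b \<phi>_def)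
    ultimately obtain s where s: "s \<in> carrier ?Z1" and se: "s (line_pt ?P) = a base_pt" "s (line_pt ?Q) = b base_pt"
      by (rule section_through[OF assms])
    have "restrict_to_pt ?P s = a" "restrict_to_pt ?Q s = b"
      using cl[OF P s] cl[OF Q s] a b se unfolding JCor_pt_CP1_0_iff restrict_to_pt_base by metis+
    moreover have "restrict_to_pt R (\<lambda>_. {#} :: 'x multiset) y = {#}" for R y
      by (simp add: restrict_to_pt_def sec_restrict_def)
    ultimately have "?d (Z1.gclass s (\<lambda>_. {#})) = w"
      using JC_diff_gclass[OF s Z1.one_closed P Q] unfolding w by simp
    moreover have "Z1.gclass s (\<lambda>_. {#}) \<in> carrier (groth ?Z1)"
      using Z1.groth_carrierI[OF s Z1.one_closed] by simp
    ultimately show "w \<in> ?d ` carrier (groth ?Z1)" by blast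
  qed
  have "JH CP1 ?P ?Q 0 pt_mfd X = groth ?Z0 Mod (?d ` carrier (groth ?Z1))"
    by (simp add: JH_def JC_cycles_def JC_M_def JC_def)
  also have "\<dots> \<cong> integer_group"
    unfolding im by (rule deg.FactGroup_iso[OF surj])
  finally show ?thesis .
qed

end
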